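(* Let $(Z,U)$ and $(Y,S)$ be topological dynamical systems and let $\pi:(Z,U)\to(Y,S)$ be a factor map which is moreover an open map. Then for every $f\in C(Z)$ we have $\alpha(f)\le\beta(f)$.
   Context: A topological dynamical system is a pair $(X,T)$ with $X$ a compact metrizable space and $T:X\to X$ a homeomorphism; $\mathcal{M}_T(X)$ denotes the set of $T$-invariant Borel probability measures on $X$ with the weak* topology. A factor map $\pi:(Z,U)\to(Y,S)$ is a continuous surjection $\pi:Z\to Y$ with $S\circ\pi=\pi\circ U$. $C(Z)$ is the space of real-valued continuous functions on $Z$. For $f\in C(Z)$ and $\nu\in\mathcal{M}_S(Y)$ set $\psi_f(\nu)=\min\{\int f\,d\lambda:\lambda\in\mathcal{M}_U(Z),\ \pi_*\lambda=\nu\}$, and $\alpha(f)=\sup_{\nu\in\mathcal{M}_S(Y)}\psi_f(\nu)$. Let $R_f=\{z\in Z:\lim_{k\to\infty}\frac1k\sum_{j=0}^{k-1}f(U^jz)\text{ exists}\}$ and $\beta(f)=\sup_{y\in\pi(R_f)}\ \inf_{z\in R_f\cap\pi^{-1}\{y\}}\ \lim_{k\to\infty}\frac1k\sum_{j=0}^{k-1}f(U^jz)$. *)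

theory Defs
  imports "HOL-Probability.Probability"
begin

definition tds :: "('a::metric_space \<Rightarrow> 'a) \<Rightarrow> bool" where
  "tds T \<longleftrightarrow> compact (UNIV :: 'a set) \<and> (\<exists>g. homeomorphism UNIV UNIV T g)"

definition factor_map ::
  "('z::topological_space \<Rightarrow> 'z) \<Rightarrow> ('y::topological_space \<Rightarrow> 'y) \<Rightarrow> ('z \<Rightarrow> 'y) \<Rightarrow> bool" where
  "factor_map U S \<pi> \<longleftrightarrow> continuous_on UNIV \<pi> \<and> surj \<pi> \<and> S \<circ> \<pi> = \<pi> \<circ> U"

definition inv_meas :: "('a::topological_space \<Rightarrow> 'a) \<Rightarrow> 'a measure set" where
  "inv_meas T = {M. sets M = sets borel \<and> prob_space M \<and> distr M borel T = M}"

definition psi ::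
  "('z::topological_space \<Rightarrow> 'z) \<Rightarrow> ('z \<Rightarrow> 'y::topological_space) \<Rightarrow> ('z \<Rightarrow> real) \<Rightarrow> 'y measure \<Rightarrow> real" where
  "psi U \<pi> f \<nu> = Inf {integral\<^sup>L m f | m. m \<in> inv_meas U \<and> distr m borel \<pi> = \<nu>}"

definition alpha ::
  "('z::topological_space \<Rightarrow> 'z) \<Rightarrow> ('y::topological_space \<Rightarrow> 'y) \<Rightarrow> ('z \<Rightarrow> 'y) \<Rightarrow> ('z \<Rightarrow> real) \<Rightarrow> real" where
  "alpha U S \<pi> f = (SUP \<nu>\<in>inv_meas S. psi U \<pi> f \<nu>)"

definition birkhoff_avg :: "('z \<Rightarrow> 'z) \<Rightarrow> ('z \<Rightarrow> real) \<Rightarrow> 'z \<Rightarrow> nat \<Rightarrow> real" where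
  "birkhoff_avg U f z k = (\<Sum>j<k. f ((U ^^ j) z)) / real k"

definition regular_set :: "('z \<Rightarrow> 'z) \<Rightarrow> ('z \<Rightarrow> real) \<Rightarrow> 'z set" where
  "regular_set U f = {z. convergent (birkhoff_avg U f z)}"

definition beta :: "('z \<Rightarrow> 'z) \<Rightarrow> ('z \<Rightarrow> 'y) \<Rightarrow> ('z \<Rightarrow> real) \<Rightarrow> real" where
  "beta U \<pi> f = (SUP y\<in>\<pi> ` regular_set U f.
      INF z\<in>regular_set U f \<inter> \<pi> -` {y}. lim (birkhoff_avg U f z))"

end

theory Submission
  imports Defs
begin

text \<open>
  Fix an invariant measure \<open>\<nu>\<close> on \<open>Y\<close> and let \<open>p g\<close> be the infimum over \<open>k \<in> C(Z)\<close> of the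
  \<open>\<nu>\<close>-integral of the fiberwise maximum of \<open>g + k - k \<circ> U\<close>. A linear functional below the
  sublinear \<open>p\<close> is a \<open>U\<close>-invariant measure over \<open>\<nu>\<close>, and by Hahn-Banach some such measure
  attains \<open>- p (- f)\<close> at \<open>f\<close>. So if \<open>c < \<psi>\<^sub>f(\<nu>)\<close>, then for some \<open>k\<close> the fiberwise minimum
  \<open>G\<close> of \<open>f - k + k \<circ> U\<close> has \<open>\<nu>\<close>-integral above \<open>c\<close>. By Birkhoff's theorem on \<open>Z\<close> there is
  a point \<open>z\<close>, regular for \<open>f\<close>, at which the averages of \<open>G \<circ> \<pi>\<close> converge to a limit above \<open>c\<close>.
  Since \<open>G \<circ> \<pi> \<le> f - k + k \<circ> U\<close> and coboundaries average out, every regular point over \<open>\<pi> z\<close>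
  has \<open>f\<close>-average above \<open>c\<close>. In particular no ergodic decomposition is needed.
\<close>

section \<open>Linear functionals below sublinear ones\<close>

definition sublinear :: "('a::real_vector \<Rightarrow> real) \<Rightarrow> bool" where
  "sublinear q \<longleftrightarrow> (\<forall>x y. q (x + y) \<le> q x + q y) \<and> (\<forall>c>0. \<forall>x. q (c *\<^sub>R x) = c * q x)"

text \<open>The opposite inequality comes from the assumed one at the factor
  \<open>inverse c\<close> and the vector \<open>c *\<^sub>R x\<close>. For functionals defined as
  infima only one direction is immediate.\<close>

lemma sublinearI:
  assumes "\<And>x y. q (x + y) \<le> q x + q y"
    and le: "\<And>c x. c > 0 \<Longrightarrow> q (c *\<^sub>R x) \<le> c * q x"
  shows "sublinear q"
proof -
  have "q (c *\<^sub>R x) = c * q x" if "c > 0" for c x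
  proof (rule antisym)
    have "q x \<le> inverse c * q (c *\<^sub>R x)"
      using le[of "inverse c" "c *\<^sub>R x"] that by simp
    then show "c * q x \<le> q (c *\<^sub>R x)"
      using that by (simp add: field_simps)
  qed (fact le[OF that])
  with assms show ?thesis by (simp add: sublinear_def)
qed

lemma sublinear_add: "sublinear q \<Longrightarrow> q (x + y) \<le> q x + q y"
  by (simp add: sublinear_def)

lemma sublinear_scaleR: "sublinear q \<Longrightarrow> c > 0 \<Longrightarrow> q (c *\<^sub>R x) = c * q x"
  by (simp add: sublinear_def)

lemma sublinear_zero: "sublinear q \<Longrightarrow> q 0 = 0"
  using sublinear_scaleR[of q 2 0] by simp

lemma sublinear_scaleR_nonneg: "sublinear q \<Longrightarrow> c \<ge> 0 \<Longrightarrow> q (c *\<^sub>R x) = c * q x"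
  using sublinear_scaleR[of q c x] sublinear_zero[of q] by (cases "c = 0") auto

lemma sublinear_ge_minus: "sublinear q \<Longrightarrow> - q (- x) \<le> q x"
  using sublinear_add[of q x "- x"] sublinear_zero[of q] by simp

text \<open>The tilted functional lies below \<open>q\<close> and is at most \<open>- q x\<close> at \<open>- x\<close>; hence a minimal
  sublinear functional is odd, and therefore linear.\<close>

lemma sublinear_tilt:
  assumes q: "sublinear q"
  shows "\<exists>r. sublinear r \<and> r \<le> q \<and> r (- x) \<le> - q x"
proof -
  \<comment> \<open>Any sublinear \<open>s \<le> q\<close> with \<open>s (- x) \<le> - q x\<close>
    has \<open>s y \<le> s (y + t *\<^sub>R x) + t * s (- x)\<close> and so lies below this infimum:
    \<open>r\<close> is the largest candidate.\<close>
  define r where "r y = (INF t\<in>{0..}. q (y + t *\<^sub>R x) - t * q x)" for y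
  have bdd: "bdd_below ((\<lambda>t. q (y + t *\<^sub>R x) - t * q x) ` {0..})" for y
  proof (rule bdd_belowI2)
    fix t :: real assume "t \<in> {0..}"
    then have "t * q x = q ((y + t *\<^sub>R x) + - y)"
      using sublinear_scaleR_nonneg[OF q, of t x] by simp
    also have "\<dots> \<le> q (y + t *\<^sub>R x) + q (- y)" by (rule sublinear_add[OF q])
    finally show "- q (- y) \<le> q (y + t *\<^sub>R x) - t * q x" by simp
  qed
  have le: "r y \<le> q (y + t *\<^sub>R x) - t * q x" if "t \<ge> 0" for y t
    unfolding r_def using that by (intro cINF_lower bdd) auto
  have "sublinear r"
  proof (rule sublinearI)
    fix y z
    \<comment> \<open>The infima in \<open>r y\<close> and \<open>r z\<close> are taken one after
      the other, the remaining terms moved to the left; the parameters add up to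
      \<open>t + s\<close>.\<close>
    have "r (y + z) - (q (z + s *\<^sub>R x) - s * q x) \<le> q (y + t *\<^sub>R x) - t * q x"
      if "t \<ge> 0" "s \<ge> 0" for s t
    proof -
      have "r (y + z) \<le> q ((y + z) + (t + s) *\<^sub>R x) - (t + s) * q x"
        using that by (intro le) auto
      also have "(y + z) + (t + s) *\<^sub>R x = (y + t *\<^sub>R x) + (z + s *\<^sub>R x)"
        by (simp add: algebra_simps)
      finally show ?thesis
        using sublinear_add[OF q, of "y + t *\<^sub>R x" "z + s *\<^sub>R x"] by (simp add: algebra_simps)
    qed
    then have "r (y + z) - (q (z + s *\<^sub>R x) - s * q x) \<le> r y" if "s \<ge> 0" for s
      unfolding r_def[of y] using that by (intro cINF_greatest) auto
    then have "r (y + z) - r y \<le> q (z + s *\<^sub>R x) - s * q x" if "s \<ge> 0" for s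
      using that by (simp add: algebra_simps)
    then have "r (y + z) - r y \<le> r z"
      unfolding r_def[of z] by (intro cINF_greatest) auto
    then show "r (y + z) \<le> r y + r z" by simp
  next
    fix c :: real and y assume c: "c > 0"
    have "r (c *\<^sub>R y) / c \<le> q (y + t *\<^sub>R x) - t * q x" if "t \<ge> 0" for t
    proof -
      have "r (c *\<^sub>R y) \<le> q (c *\<^sub>R y + (c * t) *\<^sub>R x) - (c * t) * q x"
        using c that by (intro le) auto
      also have "c *\<^sub>R y + (c * t) *\<^sub>R x = c *\<^sub>R (y + t *\<^sub>R x)"
        by (simp add: algebra_simps)
      finally have "r (c *\<^sub>R y) \<le> c * (q (y + t *\<^sub>R x) - t * q x)"
        using sublinear_scaleR[OF q c, of "y + t *\<^sub>R x"] by (simp only: right_diff_distrib mult.assoc)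
      then show ?thesis using c by (simp add: field_simps)
    qed
    then have "r (c *\<^sub>R y) / c \<le> r y"
      unfolding r_def[of y] by (intro cINF_greatest) auto
    then show "r (c *\<^sub>R y) \<le> c * r y" using c by (simp add: field_simps)
  qed
  moreover have "r \<le> q"
    using le[of 0] by (auto simp: le_fun_def)
  moreover have "r (- x) \<le> - q x"
    using le[of 1 "- x"] sublinear_zero[OF q] by simp
  ultimately show ?thesis by blast
qed

lemma linear_if_minimal_sublinear:
  assumes q: "sublinear q" and minimal: "\<And>r. sublinear r \<Longrightarrow> r \<le> q \<Longrightarrow> r = q"
  shows "linear q"
proof -
  have odd: "q (- x) = - q x" for x
  proof -
    obtain r where "sublinear r" "r \<le> q" "r (- x) \<le> - q x" using sublinear_tilt[OF q] by blast
    then have "q (- x) \<le> - q x" using minimal by blast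
    then show ?thesis using sublinear_ge_minus[OF q, of x] by simp
  qed
  show ?thesis
  proof (rule linearI)
    fix x y
    \<comment> \<open>Oddness turns subadditivity at the negated arguments into
      superadditivity.\<close>
    have "q (- x + - y) \<le> q (- x) + q (- y)" by (rule sublinear_add[OF q])
    then have "- q (x + y) \<le> - q x - q y" using odd[of "x + y"] by (simp add: odd)
    with sublinear_add[OF q, of x y] show "q (x + y) = q x + q y" by simp
  next
    fix c :: real and x
    show "q (c *\<^sub>R x) = c *\<^sub>R q x"
    proof (cases "c \<ge> 0")
      case False
      then have "q (- (c *\<^sub>R x)) = - c * q x"
        using sublinear_scaleR[OF q, of "- c" x] by simp
      then show ?thesis by (simp add: odd)
    qed (simp add: sublinear_scaleR_nonneg[OF q])
  qed
qed

text \<open>Hahn-Banach with a prescribed value. Everything below the tilt \<open>p'\<close> is at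
  most \<open>- p x\<close> at \<open>- x\<close>; a minimal sublinear functional below
  \<open>p'\<close> is linear, hence at least \<open>p x\<close> at \<open>x\<close>.\<close>

theorem linear_below_sublinear:
  assumes p: "sublinear p"
  shows "\<exists>\<phi>. linear \<phi> \<and> \<phi> \<le> p \<and> \<phi> x = p x"
proof -
  obtain p' where p': "sublinear p'" "p' \<le> p" "p' (- x) \<le> - p x"
    using sublinear_tilt[OF p] by blast
  define A where "A = {q. sublinear q \<and> q \<le> p'}"
  \<comment> \<open>Zorn's lemma for the reversed order: chains are bounded by pointwise infima (the
    empty one by \<open>p'\<close>), and maximality means minimality of the functional.\<close>
  have "\<exists>m\<in>A. \<forall>a\<in>A. a \<le> m \<longrightarrow> a = m"
  proof (rule predicate_Zorn)
    show "partial_order_on A (relation_of (\<lambda>x y. y \<le> x) A)"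
      by (auto simp: partial_order_on_def preorder_on_def refl_on_def trans_def antisym_def relation_of_def)
    fix C assume C: "C \<in> Chains (relation_of (\<lambda>x y. y \<le> x) A)"
    show "\<exists>u\<in>A. \<forall>a\<in>C. u \<le> a"
    proof (cases "C = {}")
      case False
      have chain: "q \<le> q' \<or> q' \<le> q" if "q \<in> C" "q' \<in> C" for q q'
        using C that by (auto simp: Chains_def relation_of_def)
      have CA: "sublinear q" "q \<le> p'" if "q \<in> C" for q
        using C that by (auto simp: Chains_def relation_of_def A_def)
      define u where "u y = (INF q\<in>C. q y)" for y
      \<comment> \<open>\<open>q y \<ge> - q (- y)\<close> and \<open>q \<le> p'\<close> give a
        lower bound uniform over the chain.\<close>
      have bdd: "bdd_below ((\<lambda>q. q y) ` C)" for y
      proof (rule bdd_belowI2)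
        fix q assume "q \<in> C"
        then show "- p' (- y) \<le> q y"
          using CA[of q] sublinear_ge_minus[of q y] by (auto simp: le_fun_def intro: order_trans[rotated])
      qed
      have u_le: "u y \<le> q y" if "q \<in> C" for y q
        unfolding u_def using that by (intro cINF_lower bdd)
      have "sublinear u"
      proof (rule sublinearI)
        fix y z
        have "u (y + z) - q' z \<le> q y" if qq: "q \<in> C" "q' \<in> C" for q q'
        proof -
          \<comment> \<open>The chain property replaces \<open>q\<close> and \<open>q'\<close> by
            the smaller of the two, so that the subadditivity of a single functional
            applies.\<close>
          obtain q'' where q'': "q'' \<in> C" "q'' \<le> q" "q'' \<le> q'"
            using chain[OF qq] qq by blast
          have "u (y + z) \<le> q'' y + q'' z"
            using u_le[OF q''(1), of "y + z"] sublinear_add[OF CA(1)[OF q''(1)], of y z] by simp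
          moreover have "q'' y \<le> q y" "q'' z \<le> q' z" using q'' by (auto simp: le_fun_def)
          ultimately show ?thesis by simp
        qed
        then have "u (y + z) - q' z \<le> u y" if "q' \<in> C" for q'
          unfolding u_def[of y] using that False by (intro cINF_greatest) auto
        then have "u (y + z) - u y \<le> q' z" if "q' \<in> C" for q'
          using that by (simp add: algebra_simps)
        then have "u (y + z) - u y \<le> u z"
          unfolding u_def[of z] using False by (intro cINF_greatest) auto
        then show "u (y + z) \<le> u y + u z" by simp
      next
        fix c :: real and y assume c: "c > 0"
        have "u (c *\<^sub>R y) / c \<le> q y" if "q \<in> C" for q
          using u_le[OF that, of "c *\<^sub>R y"] sublinear_scaleR[OF CA(1)[OF that] c, of y] c
          by (simp add: field_simps)
        then have "u (c *\<^sub>R y) / c \<le> u y"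
          unfolding u_def[of y] using False by (intro cINF_greatest) auto
        then show "u (c *\<^sub>R y) \<le> c * u y" using c by (simp add: field_simps)
      qed
      moreover obtain q where "q \<in> C" using False by blast
      then have "u \<le> p'" using u_le[of q] CA(2)[of q] by (meson le_fun_def order_trans)
      ultimately show ?thesis
        using u_le by (intro bexI[of _ u]) (auto simp: A_def le_fun_def)
    qed (use p' in \<open>auto simp: A_def\<close>)
  qed
  then obtain m where m: "sublinear m" "m \<le> p'"
    and minimal: "\<And>a. sublinear a \<Longrightarrow> a \<le> p' \<Longrightarrow> a \<le> m \<Longrightarrow> a = m"
    by (auto simp: A_def)
  have lin: "linear m"
    using m minimal by (intro linear_if_minimal_sublinear) (auto intro: order_trans)
  have "m (- x) \<le> - p x" using m(2) p'(3) by (auto simp: le_fun_def intro: order_trans)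
  then have "p x \<le> m x" using linear_neg[OF lin, of x] by simp
  moreover have "m \<le> p" using m(2) p'(2) by simp
  ultimately show ?thesis using lin by (intro exI[of _ m]) (auto simp: le_fun_def intro: antisym)
qed

section \<open>Birkhoff's pointwise ergodic theorem\<close>

lemma sum_funpow_Suc:
  "(\<Sum>j<Suc n. h ((T ^^ j) x)) = h x + (\<Sum>j<n. h ((T ^^ j) (T x)))"
  for h :: "'a \<Rightarrow> real"
  by (simp add: sum.lessThan_Suc_shift funpow_swap1 del: sum.lessThan_Suc)

lemma birkhoff_avg_bound:
  fixes f :: "'a \<Rightarrow> real"
  assumes "\<And>x. \<bar>f x\<bar> \<le> B"
  shows "\<bar>birkhoff_avg T f x k\<bar> \<le> B"
proof (cases "k = 0")
  \<comment> \<open>Division by zero makes the average of length 0 equal to 0, and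
    \<open>B \<ge> 0\<close> because it bounds an absolute value.\<close>
  case True
  then show ?thesis using order_trans[OF abs_ge_zero assms[of x]] by (simp add: birkhoff_avg_def)
next
  case False
  have "\<bar>\<Sum>j<k. f ((T ^^ j) x)\<bar> \<le> (\<Sum>j<k. B)"
    by (rule order_trans[OF sum_abs]) (intro sum_mono assms)
  then show ?thesis using False by (simp add: birkhoff_avg_def abs_divide field_simps)
qed

lemma birkhoff_avg_comp_diff:
  "birkhoff_avg T f (T x) k = (f ((T ^^ k) x) - f x) / real k + birkhoff_avg T f x k"
proof -
  have "(\<Sum>j<k. f ((T ^^ j) (T x))) + f x = (\<Sum>j<k. f ((T ^^ j) x)) + f ((T ^^ k) x)"
    using sum_funpow_Suc[of f T x k] by simp
  then show ?thesis
    by (simp add: birkhoff_avg_def add_divide_distrib[symmetric] algebra_simps)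
qed

text \<open>The averages at \<open>x\<close> and \<open>T x\<close> differ by a boundary term of
  size at most \<open>2 * B / k\<close>. This makes sets defined through upper and lower limits of
  averages invariant.\<close>

lemma limsup_liminf_birkhoff_avg_comp:
  fixes f :: "'a \<Rightarrow> real"
  assumes "\<And>x. \<bar>f x\<bar> \<le> B"
  shows "limsup (\<lambda>k. ereal (birkhoff_avg T f (T x) k)) = limsup (\<lambda>k. ereal (birkhoff_avg T f x k))"
    and "liminf (\<lambda>k. ereal (birkhoff_avg T f (T x) k)) = liminf (\<lambda>k. ereal (birkhoff_avg T f x k))"
proof -
  have "(\<lambda>k. (f ((T ^^ k) x) - f x) / real k) \<longlonglongrightarrow> 0"
  proof (rule Lim_null_comparison)
    show "(\<lambda>k. 2 * B / real k) \<longlonglongrightarrow> 0" by (rule lim_const_over_n)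
    show "\<forall>\<^sub>F k in sequentially. norm ((f ((T ^^ k) x) - f x) / real k) \<le> 2 * B / real k"
    proof (rule always_eventually, rule allI)
      fix k
      show "norm ((f ((T ^^ k) x) - f x) / real k) \<le> 2 * B / real k"
        using assms[of x] assms[of "(T ^^ k) x"] by (auto simp: abs_divide intro!: divide_right_mono)
    qed
  qed
  then have *: "(\<lambda>k. ereal ((f ((T ^^ k) x) - f x) / real k)) \<longlonglongrightarrow> 0"
    by (simp add: zero_ereal_def)
  show "limsup (\<lambda>k. ereal (birkhoff_avg T f (T x) k)) = limsup (\<lambda>k. ereal (birkhoff_avg T f x k))"
    unfolding birkhoff_avg_comp_diff plus_ereal.simps(1)[symmetric]
    by (subst ereal_limsup_lim_add[OF *]) auto
  show "liminf (\<lambda>k. ereal (birkhoff_avg T f (T x) k)) = liminf (\<lambda>k. ereal (birkhoff_avg T f x k))"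
    unfolding birkhoff_avg_comp_diff plus_ereal.simps(1)[symmetric]
    by (subst ereal_liminf_lim_add[OF *]) auto
qed

locale measure_preserving = prob_space M for M :: "'a measure" +
  fixes T :: "'a \<Rightarrow> 'a"
  assumes T_measurable [measurable]: "T \<in> measurable M M"
    and distr_T: "distr M M T = M"
begin

lemma funpow_measurable [measurable]: "(T ^^ n) \<in> measurable M M"
proof (induction n)
  case (Suc n)
  then show ?case using measurable_comp[OF _ T_measurable, of "T ^^ n" M] by simp
qed (simp add: id_def)

lemma integral_comp_T: "f \<in> borel_measurable M \<Longrightarrow> (\<integral>x. f (T x) \<partial>M) = integral\<^sup>L M f"
  for f :: "'a \<Rightarrow> real"
  using integral_distr[OF T_measurable, of f] unfolding distr_T by (rule sym)

lemma integral_comp_funpow: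
  "f \<in> borel_measurable M \<Longrightarrow> (\<integral>x. f ((T ^^ n) x) \<partial>M) = integral\<^sup>L M f"
  for f :: "'a \<Rightarrow> real"
proof (induction n)
  case (Suc n)
  have "(\<integral>x. f ((T ^^ Suc n) x) \<partial>M) = (\<integral>x. f ((T ^^ n) (T x)) \<partial>M)"
    by (simp add: funpow_swap1)
  also have "\<dots> = integral\<^sup>L M f"
    using Suc by (subst integral_comp_T[where f = "\<lambda>x. f ((T ^^ n) x)"]) auto
  finally show ?case .
qed simp

lemma integrable_of_bounded:
  "f \<in> borel_measurable M \<Longrightarrow> (\<And>x. \<bar>f x\<bar> \<le> B) \<Longrightarrow> integrable M f"
  for f :: "'a \<Rightarrow> real"
  by (rule integrable_const_bound[where B = B]) auto

section \<open>The maximal ergodic inequality\<close>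

text \<open>Garsia's argument: \<open>F N x\<close> is the maximum of the Birkhoff sums of length at most \<open>N\<close>, and
  \<open>F N x - F N (T x) \<le> h x\<close> wherever \<open>F N x > 0\<close>.\<close>

lemma maximal_ergodic:
  fixes h :: "'a \<Rightarrow> real"
  assumes [measurable]: "h \<in> borel_measurable M" and B: "\<And>x. \<bar>h x\<bar> \<le> B"
    and pos: "\<And>x. x \<in> space M \<Longrightarrow> h x \<noteq> 0 \<Longrightarrow> \<exists>n. (\<Sum>j<n. h ((T ^^ j) x)) > 0"
  shows "integral\<^sup>L M h \<ge> 0"
proof -
  define F where "F = rec_nat (\<lambda>x. 0) (\<lambda>_ G x. max 0 (h x + G (T x)))"
  have F0: "F 0 x = 0" and FS: "F (Suc N) x = max 0 (h x + F N (T x))" for x N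
    by (simp_all add: F_def)
  have F_meas [measurable]: "F N \<in> borel_measurable M" for N
    by (induction N) (simp_all add: F0[abs_def] FS[abs_def])
  have F_bound: "\<bar>F N x\<bar> \<le> real N * B" for N x
  proof (induction N arbitrary: x)
    case (Suc N)
    have "0 \<le> B" "h x \<le> B" "F N (T x) \<le> real N * B"
      using B[of x] Suc[of "T x"] by linarith+
    moreover have "0 \<le> F (Suc N) x" by (simp add: FS)
    ultimately have "0 \<le> F (Suc N) x" "F (Suc N) x \<le> B + real N * B"
      using mult_nonneg_nonneg[of "real N" B] by (auto simp: FS)
    then show ?case by (simp add: distrib_right)
  qed (simp add: F0)
  have F_mono: "F N x \<le> F (Suc N) x" for N x
  proof (induction N arbitrary: x)
    case (Suc N)
    from Suc[of "T x"] show ?case by (simp add: FS[of N x] FS[of "Suc N" x])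
  qed (simp add: F0 FS)
  have sum_le: "(\<Sum>j<n. h ((T ^^ j) x)) \<le> F n x" for n x
  proof (induction n arbitrary: x)
    case (Suc n)
    then show ?case using Suc[of "T x"] unfolding sum_funpow_Suc by (simp add: FS le_max_iff_disj)
  qed (simp add: F0)
  have F_nonneg: "F N x \<ge> 0" for N x by (cases N) (auto simp: F0 FS)
  have ge0: "(\<integral>x. indicator {x. F N x > 0} x * h x \<partial>M) \<ge> 0" for N
  proof -
    have int: "integrable M (F N)" "integrable M (\<lambda>x. F N (T x))"
      using F_bound by (auto intro!: integrable_of_bounded)
    \<comment> \<open>By invariance \<open>F N\<close> and \<open>F N \<circ> T\<close> have the
      same integral, so the pointwise bound on their difference integrates to the claim.\<close>
    have "0 = (\<integral>x. F N x - F N (T x) \<partial>M)"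
      using int by (simp add: integral_comp_T)
    also have "\<dots> \<le> (\<integral>x. indicator {x. F N x > 0} x * h x \<partial>M)"
    proof (rule integral_mono)
      show "integrable M (\<lambda>x. indicator {x. F N x > 0} x * h x)"
        using B order_trans[OF abs_ge_zero B]
        by (intro integrable_of_bounded[where B = B]) (auto simp: indicator_def)
      fix x
      show "F N x - F N (T x) \<le> indicator {x. F N x > 0} x * h x"
      proof (cases N)
        case (Suc N')
        show ?thesis
        proof (cases "F N x > 0")
          case True
          then have "F N x = h x + F N' (T x)" by (auto simp: Suc FS max_def split: if_splits)
          then show ?thesis using True F_mono[of N' "T x"] by (simp add: Suc)
        next
          case False
          then show ?thesis using F_nonneg[of N "T x"] by simp
        qed
      qed (simp add: F0)
    qed (use int in simp)
    finally show ?thesis .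
  qed
  \<comment> \<open>The sets \<open>{F N > 0}\<close> increase, and by \<open>pos\<close> they
    eventually contain each point where \<open>h\<close> is nonzero; elsewhere the indicator does
    not matter.\<close>
  have lim: "(\<lambda>N. (\<integral>x. indicator {x. F N x > 0} x * h x \<partial>M)) \<longlonglongrightarrow> integral\<^sup>L M h"
  proof (rule integral_dominated_convergence[where w = "\<lambda>_. B"])
    show "AE x in M. (\<lambda>N. indicator {x. F N x > 0} x * h x) \<longlonglongrightarrow> h x"
    proof (rule AE_I2, rule tendsto_eventually)
      fix x assume x: "x \<in> space M"
      show "\<forall>\<^sub>F N in sequentially. indicator {x. F N x > 0} x * h x = h x"
      proof (cases "h x = 0")
        case False
        then obtain n where "(\<Sum>j<n. h ((T ^^ j) x)) > 0" using pos[OF x] by blast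
        then have "F n x > 0" using sum_le[of x n] by simp
        then have "F N x > 0" if "N \<ge> n" for N
          using that lift_Suc_mono_le[of "\<lambda>N. F N x", OF F_mono, of n N] by simp
        then show ?thesis by (auto simp: eventually_sequentially indicator_def)
      qed simp
    qed
    show "AE x in M. norm (indicator {x. F N x > 0} x * h x) \<le> B" for N
      using B order_trans[OF abs_ge_zero B] by (auto simp: indicator_def)
  qed auto
  show ?thesis using LIMSEQ_le_const[OF lim, of 0] ge0 by blast
qed

section \<open>Almost everywhere convergence of Birkhoff averages\<close>

lemma birkhoff_avg_measurable [measurable]:
  assumes "f \<in> borel_measurable M"
  shows "(\<lambda>x. birkhoff_avg T f x k) \<in> borel_measurable M"
proof -
  have "(\<lambda>x. f ((T ^^ j) x)) \<in> borel_measurable M" for j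
    using measurable_compose[OF funpow_measurable assms] .
  then show ?thesis
    unfolding birkhoff_avg_def by (intro borel_measurable_divide borel_measurable_sum) auto
qed

text \<open>The maximal inequality for \<open>f - b\<close> cut off to \<open>E\<close>: an orbit
  starting in \<open>E\<close> stays there, and a limsup above \<open>b\<close> makes some Birkhoff
  sum of \<open>f - b\<close> positive.\<close>

lemma integral_on_invariant_ge:
  fixes f :: "'a \<Rightarrow> real"
  assumes [measurable]: "f \<in> borel_measurable M" "E \<in> sets M" and B: "\<And>x. \<bar>f x\<bar> \<le> B"
    and E: "\<And>x. x \<in> space M \<Longrightarrow> T x \<in> E \<longleftrightarrow> x \<in> E"
    and lim: "\<And>x. x \<in> E \<Longrightarrow> ereal b < limsup (\<lambda>k. ereal (birkhoff_avg T f x k))"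
  shows "(\<integral>x. indicator E x * f x \<partial>M) \<ge> b * prob E"
proof -
  have space: "(T ^^ j) x \<in> space M" if "x \<in> space M" for j x
    using measurable_space[OF funpow_measurable that] .
  have inv: "(T ^^ j) x \<in> E \<longleftrightarrow> x \<in> E" if "x \<in> space M" for j x
    using that by (induction j) (auto simp: E space)
  have B0: "0 \<le> B" using order_trans[OF abs_ge_zero B] .
  have "0 \<le> (\<integral>x. indicator E x * (f x - b) \<partial>M)"
  proof (rule maximal_ergodic[where B = "B + \<bar>b\<bar>"])
    show "\<bar>indicator E x * (f x - b)\<bar> \<le> B + \<bar>b\<bar>" for x
      using B[of x] B0 by (auto simp: indicator_def)
    fix x assume sp: "x \<in> space M" and "indicator E x * (f x - b) \<noteq> 0"
    then have x: "x \<in> E" by (auto simp: indicator_def split: if_splits)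
    have "\<exists>k>0. birkhoff_avg T f x k > b"
    proof (rule ccontr)
      assume *: "\<not> ?thesis"
      have "ereal (birkhoff_avg T f x k) \<le> ereal b" if "k \<ge> 1" for k
      proof -
        have "k > 0" using that by simp
        with * have "\<not> birkhoff_avg T f x k > b" by blast
        then show ?thesis by simp
      qed
      then have "limsup (\<lambda>k. ereal (birkhoff_avg T f x k)) \<le> ereal b"
        by (intro Limsup_bounded) (auto simp only: eventually_sequentially)
      with lim[OF x] show False by simp
    qed
    then obtain k where k: "k > 0" "birkhoff_avg T f x k > b" by blast
    then have "(\<Sum>j<k. f ((T ^^ j) x) - b) > 0"
      by (simp add: birkhoff_avg_def sum_subtractf field_simps)
    then show "\<exists>n. 0 < (\<Sum>j<n. indicator E ((T ^^ j) x) * (f ((T ^^ j) x) - b))"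
      using x sp by (intro exI[of _ k]) (simp add: indicator_def inv)
  qed measurable
  moreover have "(\<integral>x. indicator E x * (f x - b) \<partial>M) = (\<integral>x. indicator E x * f x - b * indicator E x \<partial>M)"
    by (simp add: algebra_simps)
  moreover have "integrable M (\<lambda>x. indicator E x * f x)"
    using B B0 by (intro integrable_of_bounded[where B = B]) (auto simp: indicator_def)
  ultimately show ?thesis by (simp add: emeasure_eq_measure)
qed

text \<open>On the invariant set \<open>E a b\<close>, where the averages oscillate across
  \<open>[a, b]\<close>, the integral of \<open>f\<close> is at least \<open>b\<close> and at most
  \<open>a\<close> times the measure of the set, so for \<open>a < b\<close> the set is
  null.\<close>

theorem birkhoff_AE_convergent:
  fixes f :: "'a \<Rightarrow> real"
  assumes [measurable]: "f \<in> borel_measurable M" and B: "\<And>x. \<bar>f x\<bar> \<le> B"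
  shows "AE x in M. convergent (birkhoff_avg T f x)"
proof -
  let ?A = "\<lambda>f x k. ereal (birkhoff_avg T f x k)"
  define E where "E a b = {x \<in> space M. liminf (?A f x) < ereal a \<and> ereal b < limsup (?A f x)}" for a b
  have [measurable]: "E a b \<in> sets M" for a b
    unfolding E_def by measurable
  have null: "AE x in M. x \<notin> E a b" if "a < b" for a b
  proof -
    have inv: "T x \<in> E a b \<longleftrightarrow> x \<in> E a b" if "x \<in> space M" for x
      using that measurable_space[OF T_measurable that]
      by (simp add: E_def limsup_liminf_birkhoff_avg_comp[where T = T and f = f, OF B])
    have neg: "?A (\<lambda>x. - f x) x = (\<lambda>k. - ?A f x k)" for x
      by (simp add: birkhoff_avg_def sum_negf fun_eq_iff)
    have "b * prob (E a b) \<le> (\<integral>x. indicator (E a b) x * f x \<partial>M)"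
      using B inv by (intro integral_on_invariant_ge) (auto simp: E_def)
    \<comment> \<open>The upper bound is the lower bound for \<open>- f\<close>, whose limsup is the
      negated liminf.\<close>
    moreover have "- a * prob (E a b) \<le> (\<integral>x. indicator (E a b) x * - f x \<partial>M)"
    proof (rule integral_on_invariant_ge)
      fix x assume "x \<in> E a b"
      then have "liminf (?A f x) < ereal a" by (simp add: E_def)
      then have "- ereal a < - liminf (?A f x)" by (simp only: ereal_minus_less_minus)
      then show "ereal (- a) < limsup (?A (\<lambda>x. - f x) x)"
        unfolding neg ereal_Limsup_uminus by simp
    qed (use B inv in auto)
    ultimately have "(b - a) * prob (E a b) \<le> 0" by (simp add: algebra_simps)
    with that have "prob (E a b) = 0"
      by (meson antisym diff_gt_0_iff_gt measure_nonneg mult_le_0_iff not_le)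
    then show ?thesis
      by (subst AE_iff_measurable[of "E a b"]) (auto simp: emeasure_eq_measure E_def)
  qed
  \<comment> \<open>Rational pairs suffice to detect oscillation and keep the number of null sets
    countable.\<close>
  have "AE x in M. \<forall>a b :: rat. a < b \<longrightarrow> x \<notin> E (of_rat a) (of_rat b)"
    unfolding AE_all_countable using null by (auto simp: of_rat_less)
  then show ?thesis
  proof (rule AE_mp, intro AE_I2 impI)
    fix x assume sp: "x \<in> space M" and x: "\<forall>a b :: rat. a < b \<longrightarrow> x \<notin> E (of_rat a) (of_rat b)"
    let ?l = "liminf (?A f x)" and ?L = "limsup (?A f x)"
    have bounds: "- ereal B \<le> ?A f x k" "?A f x k \<le> ereal B" for k
      using birkhoff_avg_bound[of f B T x k] B by (auto simp: abs_le_iff)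
    have "- ereal B \<le> ?l" "?L \<le> ereal B"
      using bounds by (auto intro!: Liminf_bounded Limsup_bounded)
    moreover have le: "?l \<le> ?L" by (rule Liminf_le_Limsup) simp
    moreover have "\<not> ?l < ?L"
    proof
      assume "?l < ?L"
      \<comment> \<open>The upper and lower limits are extended reals: two reals are placed between
        them first, and then two rationals between those.\<close>
      then obtain q where q: "?l < ereal q" "ereal q < ?L" using ereal_dense2 by blast
      then obtain q' where q': "ereal q < ereal q'" "ereal q' < ?L" using ereal_dense2 by blast
      then have "q < q'" by simp
      then obtain r where r: "q < of_rat r" "of_rat r < q'" using of_rat_dense by blast
      obtain s where s: "(of_rat r :: real) < of_rat s" "of_rat s < q'" using of_rat_dense[OF r(2)] by blast
      have "?l < ereal (of_rat r)" using less_trans[of ?l "ereal q" "ereal (of_rat r)"] q(1) r(1) by simp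
      moreover have "ereal (of_rat s) < ?L" using less_trans[of "ereal (of_rat s)" "ereal q'" ?L] q'(2) s(2) by simp
      ultimately have "x \<in> E (of_rat r) (of_rat s)" using sp by (simp add: E_def)
      moreover have "r < s" using s(1) by (simp add: of_rat_less)
      ultimately show False using x by blast
    qed
    ultimately obtain c where c: "?l = ereal c" "?L = ereal c"
      by (cases ?l) (auto simp: less_le)
    then have "(\<lambda>k. ?A f x k) \<longlonglongrightarrow> ereal c"
      by (intro Liminf_eq_Limsup) auto
    then show "convergent (birkhoff_avg T f x)" by (auto simp: convergent_def)
  qed
qed

text \<open>All averages have the integral of \<open>g\<close>, so by dominated convergence the
  limit has it too and cannot be at most \<open>c\<close> almost everywhere. The predicate
  \<open>P\<close> lets the point satisfy a further almost sure property.\<close>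

lemma exists_lim_birkhoff_avg_gt:
  fixes g :: "'a \<Rightarrow> real"
  assumes [measurable]: "g \<in> borel_measurable M" and B: "\<And>x. \<bar>g x\<bar> \<le> B"
    and c: "c < integral\<^sup>L M g" and P: "AE x in M. P x"
  shows "\<exists>x. P x \<and> convergent (birkhoff_avg T g x) \<and> c < lim (birkhoff_avg T g x)"
proof (rule ccontr)
  assume *: "\<not> ?thesis"
  let ?L = "\<lambda>x. lim (birkhoff_avg T g x)"
  have conv: "AE x in M. convergent (birkhoff_avg T g x)"
    using B by (intro birkhoff_AE_convergent) auto
  have [measurable]: "?L \<in> borel_measurable M"
    by (rule borel_measurable_lim_metric) (rule birkhoff_avg_measurable, fact)
  have "AE x in M. (\<lambda>k. birkhoff_avg T g x k) \<longlonglongrightarrow> ?L x"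
    using conv by eventually_elim (simp add: convergent_LIMSEQ_iff)
  then have lim: "(\<lambda>k. \<integral>x. birkhoff_avg T g x k \<partial>M) \<longlonglongrightarrow> integral\<^sup>L M ?L"
    and int: "integrable M ?L"
    using birkhoff_avg_bound[of g B T, OF B]
    by (auto intro!: integral_dominated_convergence[where w = "\<lambda>_. B"]
        integrable_dominated_convergence[where w = "\<lambda>_. B" and s = "\<lambda>k x. birkhoff_avg T g x k"])
  \<comment> \<open>Length 0 is left out, since the average there is 0 by convention.\<close>
  have "(\<integral>x. birkhoff_avg T g x k \<partial>M) = integral\<^sup>L M g" if "k \<ge> 1" for k
  proof -
    have "integrable M (\<lambda>x. g ((T ^^ j) x))" for j
      using B measurable_compose[OF funpow_measurable assms(1)] by (intro integrable_of_bounded)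
    then have "(\<integral>x. birkhoff_avg T g x k \<partial>M) = (\<Sum>j<k. \<integral>x. g ((T ^^ j) x) \<partial>M) / real k"
      by (simp add: birkhoff_avg_def)
    then show ?thesis using that by (simp add: integral_comp_funpow)
  qed
  then have "(\<lambda>k. \<integral>x. birkhoff_avg T g x k \<partial>M) \<longlonglongrightarrow> integral\<^sup>L M g"
    by (intro tendsto_eventually) (auto simp only: eventually_sequentially)
  with lim have "integral\<^sup>L M ?L = integral\<^sup>L M g" by (rule LIMSEQ_unique)
  moreover have "AE x in M. ?L x \<le> c"
    using conv P * by (auto simp: not_less elim!: eventually_elim2)
  then have "integral\<^sup>L M ?L \<le> (\<integral>x. c \<partial>M)"
    using int by (intro integral_mono_AE) auto
  ultimately show False using c by (simp add: prob_space)
qed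

end

section \<open>Riesz representation on compact metric spaces\<close>

lemma continuous_on_compact_UNIV_bounded:
  fixes g :: "'a::topological_space \<Rightarrow> real"
  assumes "compact (UNIV :: 'a set)" "continuous_on UNIV g"
  shows "\<exists>B. \<forall>x. \<bar>g x\<bar> \<le> B"
  using compact_imp_bounded[OF compact_continuous_image[OF assms(2,1)]] by (simp add: bounded_iff)

text \<open>The approximants are multiples of the distance to the complement, capped at 1. Starting
  at 0 and increasing makes their increments a series of nonnegative functions with sum the
  indicator.\<close>

lemma open_indicator_limit:
  fixes A :: "'a::metric_space set"
  assumes "open A"
  obtains u :: "nat \<Rightarrow> 'a \<Rightarrow> real" where
    "\<And>k. continuous_on UNIV (u k)" "\<And>k x. 0 \<le> u k x" "\<And>k x. u k x \<le> 1" "\<And>x. u 0 x = 0"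
    "\<And>x. incseq (\<lambda>k. u k x)" "\<And>x. (\<lambda>k. u k x) \<longlonglongrightarrow> indicator A x" "\<And>k x. x \<notin> A \<Longrightarrow> u k x = 0"
proof
  \<comment> \<open>\<open>infdist\<close> to the empty set is 0, so the whole space needs a value
    of its own.\<close>
  define d where "d x = (if A = UNIV then 1 else infdist x (- A))" for x
  define u where "u k x = min 1 (real k * d x)" for k x
  have d0: "d x \<ge> 0" for x by (simp add: d_def infdist_nonneg)
  have d_out: "d x = 0" if "x \<notin> A" for x using that by (auto simp: d_def)
  have d_in: "d x > 0" if "x \<in> A" for x
  proof (cases "A = UNIV")
    case False
    have "infdist x (- A) \<noteq> 0"
      using that False \<open>open A\<close> in_closed_iff_infdist_zero[of "- A" x] by auto
    with False show ?thesis using infdist_nonneg[of x "- A"] by (simp add: d_def)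
  qed (simp add: d_def)
  have "continuous_on UNIV d"
    unfolding d_def by (cases "A = UNIV") (auto intro: continuous_intros)
  then show "continuous_on UNIV (u k)" for k
    unfolding u_def by (intro continuous_intros)
  show "0 \<le> u k x" "u k x \<le> 1" "u 0 x = 0" for k x
    using d0[of x] by (auto simp: u_def)
  show "incseq (\<lambda>k. u k x)" for x
  proof (rule monoI)
    fix k l :: nat assume "k \<le> l"
    then have "real k * d x \<le> real l * d x" using d0 by (intro mult_right_mono) auto
    then show "u k x \<le> u l x" by (simp add: u_def min.coboundedI2)
  qed
  show out: "u k x = 0" if "x \<notin> A" for k x
    using d_out[OF that] by (simp add: u_def)
  show "(\<lambda>k. u k x) \<longlonglongrightarrow> indicator A x" for x
  proof (cases "x \<in> A")
    case True
    obtain n where n: "1 < real n * d x" using reals_Archimedean3[OF d_in[OF True]] by blast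
    have "u k x = 1" if "k \<ge> n" for k
    proof -
      have "real n * d x \<le> real k * d x" using that d0 by (intro mult_right_mono) auto
      with n show ?thesis by (simp add: u_def)
    qed
    then have "(\<lambda>k. u k x) \<longlonglongrightarrow> 1"
      by (intro tendsto_eventually) (auto simp: eventually_sequentially)
    then show ?thesis using True by simp
  qed (simp add: out)
qed

text \<open>Integrals of continuous approximants of the indicator determine the measure of each open
  set, and open sets form an intersection-stable generator.\<close>

lemma measure_eqI_continuous:
  fixes M N :: "'a::metric_space measure"
  assumes "finite_measure M" "finite_measure N"
    and sets: "sets M = sets borel" "sets N = sets borel"
    and eq: "\<And>f. continuous_on UNIV f \<Longrightarrow> (\<And>x. \<bar>f x\<bar> \<le> 1) \<Longrightarrow> integral\<^sup>L M f = (integral\<^sup>L N f :: real)"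
  shows "M = N"
proof -
  interpret M: finite_measure M by fact
  interpret N: finite_measure N by fact
  have measure_lim: "(\<lambda>k. integral\<^sup>L K (u k)) \<longlonglongrightarrow> measure K A"
    if K: "finite_measure K" "sets K = sets borel" and A: "open A"
      and u: "\<And>k. continuous_on UNIV (u k)" "\<And>k x. 0 \<le> u k x" "\<And>k x. u k x \<le> 1"
        "\<And>x. (\<lambda>k. u k x) \<longlonglongrightarrow> indicator A x"
    for K :: "'a measure" and u :: "nat \<Rightarrow> 'a \<Rightarrow> real" and A
  proof -
    interpret K: finite_measure K by fact
    have [measurable_cong]: "sets K = sets borel" by fact
    have [measurable]: "u k \<in> borel_measurable borel" for k
      using u(1) by (rule borel_measurable_continuous_onI)
    have A' [measurable]: "A \<in> sets borel" using A by simp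
    have "(\<lambda>k. integral\<^sup>L K (u k)) \<longlonglongrightarrow> integral\<^sup>L K (indicator A :: 'a \<Rightarrow> real)"
      using u by (intro integral_dominated_convergence[where w = "\<lambda>_. 1"]) auto
    moreover have "integral\<^sup>L K (indicator A :: 'a \<Rightarrow> real) = measure K A"
      using A' K(2) sets_eq_imp_space_eq[OF K(2)] by simp
    ultimately show ?thesis by simp
  qed
  have eq_open: "emeasure M A = emeasure N A" if A: "open A" for A
  proof -
    obtain u :: "nat \<Rightarrow> 'a \<Rightarrow> real" where u: "\<And>k. continuous_on UNIV (u k)" "\<And>k x. 0 \<le> u k x"
        "\<And>k x. u k x \<le> 1" "\<And>x. (\<lambda>k. u k x) \<longlonglongrightarrow> indicator A x"
      using open_indicator_limit[OF A] by metis
    have "integral\<^sup>L M (u k) = integral\<^sup>L N (u k)" for k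
      using u by (intro eq) (auto simp: abs_le_iff intro: order_trans[of _ 0])
    then have "measure M A = measure N A"
      using measure_lim[OF assms(1) sets(1) A, of u] measure_lim[OF assms(2) sets(2) A, of u] u
      by (auto intro: LIMSEQ_unique)
    then show ?thesis by (simp add: M.emeasure_eq_measure N.emeasure_eq_measure)
  qed
  show ?thesis
    by (rule measure_eqI_generator_eq[where E = "{A. open A}" and \<Omega> = UNIV and A = "\<lambda>_. UNIV"])
      (auto simp: Int_stable_def eq_open sets sets_borel M.emeasure_finite)
qed

section \<open>Positive functionals and their outer measure\<close>

locale positive_functional =
  fixes \<Lambda> :: "('a::metric_space \<Rightarrow> real) \<Rightarrow> real"
  assumes compact_UNIV: "compact (UNIV :: 'a set)"
    and add: "\<And>f g. continuous_on UNIV f \<Longrightarrow> continuous_on UNIV g \<Longrightarrow> \<Lambda> (\<lambda>x. f x + g x) = \<Lambda> f + \<Lambda> g"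
    and scale: "\<And>c f. continuous_on UNIV f \<Longrightarrow> \<Lambda> (\<lambda>x. c * f x) = c * \<Lambda> f"
    and nonneg: "\<And>f. continuous_on UNIV f \<Longrightarrow> (\<And>x. 0 \<le> f x) \<Longrightarrow> 0 \<le> \<Lambda> f"
begin

lemma zero: "\<Lambda> (\<lambda>x. 0) = 0"
  using scale[of "\<lambda>x. 0" 0] by simp

lemma diff: "continuous_on UNIV f \<Longrightarrow> continuous_on UNIV g \<Longrightarrow> \<Lambda> (\<lambda>x. f x - g x) = \<Lambda> f - \<Lambda> g"
  using add[of f "\<lambda>x. (- 1) * g x"] scale[of g "- 1"] by (simp add: continuous_intros)

lemma mono:
  assumes "continuous_on UNIV f" "continuous_on UNIV g" "\<And>x. f x \<le> g x"
  shows "\<Lambda> f \<le> \<Lambda> g"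
  using nonneg[of "\<lambda>x. g x - f x"] diff[of g f] assms by (simp add: continuous_intros)

lemma const: "\<Lambda> (\<lambda>x. c) = c * \<Lambda> (\<lambda>x. 1)"
  using scale[of "\<lambda>x. 1" c] by simp

lemma sum:
  fixes n :: nat
  assumes "\<And>i. continuous_on UNIV (g i)"
  shows "\<Lambda> (\<lambda>x. \<Sum>i<n. g i x) = (\<Sum>i<n. \<Lambda> (g i))"
proof (induction n)
  case (Suc n)
  then show ?case
    using add[of "\<lambda>x. \<Sum>i<n. g i x" "g n"] assms by (simp add: continuous_intros)
qed (simp add: zero)

definition covers :: "(nat \<Rightarrow> 'a \<Rightarrow> real) \<Rightarrow> 'a set \<Rightarrow> bool" where
  "covers g A \<longleftrightarrow> (\<forall>i. continuous_on UNIV (g i) \<and> (\<forall>x. 0 \<le> g i x)) \<and> (\<forall>x\<in>A. 1 \<le> (\<Sum>i. ennreal (g i x)))"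

text \<open>Daniell's upper integral of the indicator of \<open>A\<close>, with countable sums of
  nonnegative continuous functions as majorants. Values in \<open>ennreal\<close> spare all
  summability conditions.\<close>

definition outer :: "'a set \<Rightarrow> ennreal" where
  "outer A = (INF g\<in>{g. covers g A}. \<Sum>i. ennreal (\<Lambda> (g i)))"

lemma coversD: "covers g A \<Longrightarrow> continuous_on UNIV (g i)" "covers g A \<Longrightarrow> 0 \<le> g i x"
  "covers g A \<Longrightarrow> x \<in> A \<Longrightarrow> 1 \<le> (\<Sum>i. ennreal (g i x))"
  by (auto simp: covers_def)

lemma outer_le: "covers g A \<Longrightarrow> outer A \<le> (\<Sum>i. ennreal (\<Lambda> (g i)))"
  unfolding outer_def by (rule INF_lower) simp

lemma outer_less: "outer A < c \<Longrightarrow> \<exists>g. covers g A \<and> (\<Sum>i. ennreal (\<Lambda> (g i))) < c"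
  unfolding outer_def by (auto simp: INF_less_iff)

text \<open>Doubly indexed covers arise from countable unions and from splitting each function of a
  cover into a series; they are re-indexed along \<open>prod_decode\<close>.\<close>

lemma outer_le_double:
  assumes "\<And>i k. continuous_on UNIV (g i k)" "\<And>i k x. 0 \<le> g i k x"
    and "\<And>x. x \<in> A \<Longrightarrow> 1 \<le> (\<Sum>i. \<Sum>k. ennreal (g i k x))"
  shows "outer A \<le> (\<Sum>i. \<Sum>k. ennreal (\<Lambda> (g i k)))"
proof -
  have flat: "(\<Sum>j. case_prod h (prod_decode j)) = (\<Sum>i. \<Sum>k. h i k)" for h :: "nat \<Rightarrow> nat \<Rightarrow> ennreal"
    by (rule suminf_ennreal_2dimen) simp
  define G where "G j = case_prod g (prod_decode j)" for j
  have "covers G A"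
    unfolding covers_def
  proof (intro conjI allI ballI)
    show "continuous_on UNIV (G j)" "0 \<le> G j x" for j x
      using assms by (auto simp: G_def split: prod.split)
    fix x assume "x \<in> A"
    then show "1 \<le> (\<Sum>j. ennreal (G j x))"
      using assms(3)[of x] flat[of "\<lambda>i k. ennreal (g i k x)"] by (simp add: G_def case_prod_unfold)
  qed
  from outer_le[OF this] show ?thesis
    using flat[of "\<lambda>i k. ennreal (\<Lambda> (g i k))"] by (simp add: G_def case_prod_unfold)
qed

lemma outer_mono: "A \<subseteq> B \<Longrightarrow> outer A \<le> outer B"
  unfolding outer_def by (intro INF_superset_mono) (auto simp: covers_def)

lemma outer_le_single:
  assumes g: "continuous_on UNIV g" "\<And>x. 0 \<le> g x" "\<And>x. x \<in> A \<Longrightarrow> 1 \<le> g x"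
  shows "outer A \<le> ennreal (\<Lambda> g)"
proof -
  define G where "G i = (if i = 0 then g else (\<lambda>x. 0))" for i :: nat
  \<comment> \<open>\<open>\<phi>\<close> is used both as evaluation at a point, to check the cover,
    and as \<open>\<Lambda>\<close>, to compute its cost.\<close>
  have s: "(\<Sum>i. ennreal (\<phi> (G i))) = ennreal (\<phi> g)" if "\<phi> (\<lambda>x. 0) = 0" for \<phi> :: "('a \<Rightarrow> real) \<Rightarrow> real"
    using that suminf_finite[of "{0}" "\<lambda>i. ennreal (\<phi> (G i))"] by (simp add: G_def)
  have "covers G A"
    using g s[of "\<lambda>f. f x" for x] by (auto simp: covers_def) (auto simp: G_def)
  from outer_le[OF this] show ?thesis using s[of \<Lambda>] zero by simp
qed

lemma outer_countably_subadditive: "outer (\<Union>n. A n) \<le> (\<Sum>n. outer (A n))"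
proof (rule ennreal_le_epsilon)
  fix e :: real assume e: "0 < e" and fin: "(\<Sum>n. outer (A n)) < top"
  \<comment> \<open>The \<open>n\<close>-th set gets a cover with excess below
    \<open>e / 2 ^ (n + 1)\<close>; these excesses sum to \<open>e\<close>.\<close>
  have "outer (A n) < outer (A n) + ennreal e * ennreal ((1/2) ^ Suc n)" for n
  proof -
    have "outer (A n) < top" using fin by (rule ennreal_suminf_lessD)
    moreover have "0 < ennreal e * ennreal ((1/2) ^ Suc n)"
      using e by (simp add: ennreal_mult[symmetric])
    ultimately show ?thesis by (auto simp: less_top)
  qed
  then have "\<exists>g. covers g (A n) \<and> (\<Sum>i. ennreal (\<Lambda> (g i))) < outer (A n) + ennreal e * ennreal ((1/2) ^ Suc n)" for n
    by (rule outer_less)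
  then obtain g where g: "\<And>n. covers (g n) (A n)"
    and less: "\<And>n. (\<Sum>i. ennreal (\<Lambda> (g n i))) < outer (A n) + ennreal e * ennreal ((1/2) ^ Suc n)"
    by metis
  have "outer (\<Union>n. A n) \<le> (\<Sum>n. \<Sum>i. ennreal (\<Lambda> (g n i)))"
  proof (rule outer_le_double)
    fix x assume "x \<in> (\<Union>n. A n)"
    then obtain n where "x \<in> A n" by blast
    then have "1 \<le> (\<Sum>i. ennreal (g n i x))" by (rule coversD[OF g])
    also have "\<dots> \<le> (\<Sum>n. \<Sum>i. ennreal (g n i x))"
      using sum_le_suminf[of "\<lambda>n. \<Sum>i. ennreal (g n i x)" "{n}"] by simp
    finally show "1 \<le> (\<Sum>n. \<Sum>i. ennreal (g n i x))" .
  qed (use coversD[OF g] in auto)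
  also have "\<dots> \<le> (\<Sum>n. outer (A n) + ennreal e * ennreal ((1/2) ^ Suc n))"
    using less by (intro suminf_le) (auto intro: less_imp_le)
  also have "\<dots> = (\<Sum>n. outer (A n)) + (\<Sum>n. ennreal e * ennreal ((1/2) ^ Suc n))"
    by (rule suminf_add[symmetric]) auto
  also have "\<dots> = (\<Sum>n. outer (A n)) + e"
    unfolding ennreal_suminf_cmult
    by (subst suminf_ennreal_eq[OF zero_le_power power_half_series]) auto
  finally show "outer (\<Union>n. A n) \<le> (\<Sum>n. outer (A n)) + e" .
qed

lemma outer_empty: "outer {} = 0"
  using outer_le_single[of "\<lambda>x. 0" "{}"] zero by simp

lemma outer_measure_space_outer: "outer_measure_space (Pow UNIV) outer"
  using outer_empty outer_mono outer_countably_subadditive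
  by (auto simp: outer_measure_space_def positive_def increasing_def countably_subadditive_def)

text \<open>Caratheodory's condition for open sets. A cover \<open>g\<close> of \<open>A\<close>
  splits as \<open>g i * u n\<close> plus \<open>g i * (1 - u n)\<close>: the second family covers
  \<open>A - V\<close> because \<open>u n\<close> vanishes off \<open>V\<close>, and the first
  covers \<open>A \<inter> V\<close> in the limit.\<close>

lemma open_splits_outer:
  assumes V: "open V"
  shows "outer (A \<inter> V) + outer (A - V) \<le> outer A"
  unfolding outer_def[of A]
proof (rule INF_greatest)
  fix g assume "g \<in> {g. covers g A}"
  then have g: "covers g A" by simp
  obtain u :: "nat \<Rightarrow> 'a \<Rightarrow> real" where u: "\<And>k. continuous_on UNIV (u k)" "\<And>k x. 0 \<le> u k x"
      "\<And>k x. u k x \<le> 1" "\<And>x. u 0 x = 0" "\<And>x. incseq (\<lambda>k. u k x)"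
      "\<And>x. (\<lambda>k. u k x) \<longlonglongrightarrow> indicator V x" "\<And>k x. x \<notin> V \<Longrightarrow> u k x = 0"
    using open_indicator_limit[OF V] by metis
  note gc = coversD(1)[OF g] and g0 = coversD(2)[OF g]
  define a where "a i k = \<Lambda> (\<lambda>x. g i x * u k x)" for i k
  have mono_u: "u k x \<le> u (Suc k) x" for k x by (rule incseq_SucD[OF u(5)])
  have cont: "continuous_on UNIV (\<lambda>x. g i x * u k x)" for i k
    using gc u(1) by (intro continuous_intros)
  have a_mono: "a i k \<le> a i (Suc k)" for i k
    unfolding a_def using mono_u g0 by (intro mono cont mult_left_mono)
  have a0: "a i 0 = 0" for i by (simp add: a_def u(4) zero)
  have a_nonneg: "0 \<le> a i k" for i k
    unfolding a_def using g0 u(2) by (intro nonneg cont) simp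
  have "outer (A \<inter> V) \<le> (\<Sum>i. \<Sum>k. ennreal (\<Lambda> (\<lambda>x. g i x * u (Suc k) x - g i x * u k x)))"
  proof (rule outer_le_double)
    show "continuous_on UNIV (\<lambda>x. g i x * u (Suc k) x - g i x * u k x)" for i k
      by (intro continuous_on_diff cont)
    show nn: "0 \<le> g i x * u (Suc k) x - g i x * u k x" for i k x
      using mult_left_mono[OF mono_u g0] by simp
    fix x assume x: "x \<in> A \<inter> V"
    \<comment> \<open>On \<open>V\<close> the increments telescope from \<open>u 0 = 0\<close> to
      the limit 1.\<close>
    have "(\<Sum>k. ennreal (g i x * u (Suc k) x - g i x * u k x)) = ennreal (g i x)" for i
    proof (rule suminf_ennreal_eq[OF nn])
      have "(\<lambda>k. g i x * u k x) \<longlonglongrightarrow> g i x * indicator V x"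
        using u(6) by (intro tendsto_intros)
      from telescope_sums[OF this] show "(\<lambda>k. g i x * u (Suc k) x - g i x * u k x) sums g i x"
        using x u(4) by simp
    qed
    then show "1 \<le> (\<Sum>i. \<Sum>k. ennreal (g i x * u (Suc k) x - g i x * u k x))"
      using coversD(3)[OF g, of x] x by simp
  qed
  also have "\<dots> = (\<Sum>i. \<Sum>k. ennreal (a i (Suc k) - a i k))"
    by (simp add: a_def diff[OF cont cont])
  also have "\<dots> = (\<Sum>i. SUP n. ennreal (a i n))"
  proof -
    have "(\<Sum>k<n. ennreal (a i (Suc k) - a i k)) = ennreal (a i n)" for i n
      using a_mono by (subst sum_ennreal) (auto simp: sum_lessThan_telescope a0)
    then show ?thesis by (simp add: suminf_eq_SUP)
  qed
  \<comment> \<open>Monotonicity of \<open>a i\<close> allows the supremum to be taken outside the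
    sum over \<open>i\<close>.\<close>
  also have "\<dots> = (SUP n. \<Sum>i. ennreal (a i n))"
    using a_mono by (intro ennreal_suminf_SUP_eq) (auto intro!: incseq_SucI ennreal_leI)
  finally have 1: "outer (A \<inter> V) \<le> (SUP n. \<Sum>i. ennreal (a i n))" .
  have 2: "(\<Sum>i. ennreal (a i n)) + outer (A - V) \<le> (\<Sum>i. ennreal (\<Lambda> (g i)))" for n
  proof -
    have cont': "continuous_on UNIV (\<lambda>x. g i x - g i x * u n x)" for i
      by (intro continuous_on_diff cont gc)
    have nn': "0 \<le> g i x - g i x * u n x" for i x
    proof -
      have "g i x * u n x \<le> g i x * 1" by (intro mult_left_mono u(3) g0)
      then show ?thesis by simp
    qed
    have "covers (\<lambda>i x. g i x - g i x * u n x) (A - V)"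
      unfolding covers_def using cont' nn' coversD(3)[OF g] u(7) by auto
    then have "outer (A - V) \<le> (\<Sum>i. ennreal (\<Lambda> (\<lambda>x. g i x - g i x * u n x)))"
      by (rule outer_le)
    then have "(\<Sum>i. ennreal (a i n)) + outer (A - V)
        \<le> (\<Sum>i. ennreal (a i n)) + (\<Sum>i. ennreal (\<Lambda> (\<lambda>x. g i x - g i x * u n x)))"
      by (rule add_left_mono)
    also have "\<dots> = (\<Sum>i. ennreal (a i n) + ennreal (\<Lambda> (\<lambda>x. g i x - g i x * u n x)))"
      by (rule suminf_add) auto
    also have "\<dots> = (\<Sum>i. ennreal (\<Lambda> (g i)))"
    proof -
      have "ennreal (a i n) + ennreal (\<Lambda> (\<lambda>x. g i x - g i x * u n x)) = ennreal (\<Lambda> (g i))" for i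
        using nonneg[OF cont' nn', of i] a_nonneg[of i n]
        by (subst ennreal_plus[symmetric]) (auto simp: a_def diff[OF gc cont])
      then show ?thesis by simp
    qed
    finally show ?thesis .
  qed
  have "outer (A \<inter> V) + outer (A - V) \<le> (SUP n. \<Sum>i. ennreal (a i n)) + outer (A - V)"
    using 1 by (rule add_right_mono)
  also have "\<dots> = (SUP n. (\<Sum>i. ennreal (a i n)) + outer (A - V))"
    by (rule ennreal_SUP_add_left[symmetric]) auto
  also have "\<dots> \<le> (\<Sum>i. ennreal (\<Lambda> (g i)))"
    using 2 by (intro SUP_least)
  finally show "outer (A \<inter> V) + outer (A - V) \<le> (\<Sum>i. ennreal (\<Lambda> (g i)))" .
qed

text \<open>The lower bound is a Dini argument: for \<open>c < 1\<close> the open sets where partial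
  sums exceed \<open>c\<close> cover the compact space, so one partial sum exceeds \<open>c\<close>
  everywhere; then \<open>c\<close> tends to 1.\<close>

lemma outer_UNIV: "outer UNIV = ennreal (\<Lambda> (\<lambda>x. 1))"
proof (rule antisym)
  show "outer UNIV \<le> ennreal (\<Lambda> (\<lambda>x. 1))"
    by (rule outer_le_single) auto
  show "ennreal (\<Lambda> (\<lambda>x. 1)) \<le> outer UNIV"
    unfolding outer_def
  proof (rule INF_greatest)
    fix g assume "g \<in> {g. covers g UNIV}"
    then have g: "covers g UNIV" by simp
    note gc = coversD(1)[OF g] and g0 = coversD(2)[OF g]
    have le: "ennreal (c * \<Lambda> (\<lambda>x. 1)) \<le> (\<Sum>i. ennreal (\<Lambda> (g i)))" if c: "0 < c" "c < 1" for c
    proof -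
      define V where "V n = {x. c < (\<Sum>i<n. g i x)}" for n
      have "open (V n)" for n
        unfolding V_def using gc by (intro open_Collect_less continuous_intros)
      moreover have "UNIV \<subseteq> (\<Union>n. V n)"
      proof
        fix x
        have "ennreal c < 1" using c by (simp add: ennreal_less_one_iff)
        also have "1 \<le> (\<Sum>i. ennreal (g i x))" using coversD(3)[OF g] by simp
        also have "\<dots> = (SUP n. ennreal (\<Sum>i<n. g i x))"
          using g0 by (simp add: suminf_eq_SUP)
        finally obtain n where "ennreal c < ennreal (\<Sum>i<n. g i x)" by (auto simp: less_SUP_iff)
        then show "x \<in> (\<Union>n. V n)" using c by (auto simp: V_def ennreal_less_iff)
      qed
      ultimately obtain N where N: "finite N" "UNIV \<subseteq> (\<Union>n\<in>N. V n)"
        using compactE_image[OF compact_UNIV, of UNIV V] by auto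
      \<comment> \<open>The extra 0 makes the maximum meaningful without showing \<open>N\<close>
        nonempty.\<close>
      define n where "n = Max (insert 0 N)"
      have ge: "c \<le> (\<Sum>i<n. g i x)" for x
      proof -
        obtain k where k: "k \<in> N" "x \<in> V k" using N by blast
        then have "k \<le> n" using N(1) by (simp add: n_def)
        then have "(\<Sum>i<k. g i x) \<le> (\<Sum>i<n. g i x)" using g0 by (intro sum_mono2) auto
        with k show ?thesis by (simp add: V_def)
      qed
      have "c * \<Lambda> (\<lambda>x. 1) \<le> (\<Sum>i<n. \<Lambda> (g i))"
        using mono[of "\<lambda>x. c" "\<lambda>x. \<Sum>i<n. g i x"] ge gc by (simp add: const[of c] sum continuous_intros)
      then have "ennreal (c * \<Lambda> (\<lambda>x. 1)) \<le> (\<Sum>i<n. ennreal (\<Lambda> (g i)))"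
        using nonneg[OF gc g0] by (subst sum_ennreal) (auto intro: ennreal_leI)
      also have "\<dots> \<le> (\<Sum>i. ennreal (\<Lambda> (g i)))" by (intro sum_le_suminf) auto
      finally show ?thesis .
    qed
    show "ennreal (\<Lambda> (\<lambda>x. 1)) \<le> (\<Sum>i. ennreal (\<Lambda> (g i)))"
    proof (cases "(\<Sum>i. ennreal (\<Lambda> (g i)))")
      case (real l)
      have "c * \<Lambda> (\<lambda>x. 1) \<le> l" if "0 < c" "c < 1" for c
        using le[OF that] real by (simp add: ennreal_le_iff)
      then have "\<Lambda> (\<lambda>x. 1) \<le> l" by (rule field_le_mult_one_interval)
      then show ?thesis using real by (simp add: ennreal_leI)
    qed simp
  qed
qed

section \<open>The representing measure and its integrals\<close>

definition riesz :: "'a measure" where "riesz = measure_of UNIV (sets borel) outer"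

lemma sets_riesz [simp, measurable_cong]: "sets riesz = sets borel"
  using sets.sigma_sets_eq[of "borel :: 'a measure"] by (simp add: riesz_def)

lemma space_riesz [simp]: "space riesz = UNIV"
  using sets_eq_imp_space_eq[OF sets_riesz] by simp

text \<open>By Caratheodory \<open>outer\<close> is a measure on the sigma-algebra of splitting
  sets, which contains the open sets and hence all Borel sets.\<close>

lemma emeasure_riesz:
  assumes "A \<in> sets borel"
  shows "emeasure riesz A = outer A"
proof -
  let ?L = "lambda_system UNIV (Pow UNIV) outer"
  interpret P: sigma_algebra "UNIV :: 'a set" "Pow UNIV" by (rule sigma_algebra_Pow)
  have L: "measure_space UNIV ?L outer"
    using outer_measure_space_outer by (rule P.caratheodory_lemma)
  have "V \<in> ?L" if V: "open V" for V
  proof -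
    have "outer (V \<inter> A) + outer ((UNIV - V) \<inter> A) = outer A" for A
    proof (rule antisym)
      have "(UNIV - V) \<inter> A = A - V" by auto
      then show "outer (V \<inter> A) + outer ((UNIV - V) \<inter> A) \<le> outer A"
        using open_splits_outer[OF V, of A] by (simp add: Int_commute)
      \<comment> \<open>Subadditivity for two sets, read off from the countable form by padding with
        empty sets.\<close>
      have "outer A = outer (\<Union>n. binaryset (V \<inter> A) ((UNIV - V) \<inter> A) n)"
        by (rule arg_cong[where f = outer]) (auto simp: UN_binaryset_eq)
      also have "\<dots> \<le> (\<Sum>n. outer (binaryset (V \<inter> A) ((UNIV - V) \<inter> A) n))"
        by (rule outer_countably_subadditive)
      also have "\<dots> = outer (V \<inter> A) + outer ((UNIV - V) \<inter> A)"
        by (rule suminf_binaryset_eq) (rule outer_empty)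
      finally show "outer A \<le> outer (V \<inter> A) + outer ((UNIV - V) \<inter> A)" .
    qed
    then show ?thesis by (simp add: lambda_system_def)
  qed
  moreover have "sigma_algebra UNIV ?L" using L by (simp add: measure_space_def)
  ultimately have "sets (borel :: 'a measure) \<subseteq> ?L"
    unfolding sets_borel by (intro sigma_algebra.sigma_sets_subset) auto
  moreover have "sigma_algebra (UNIV :: 'a set) (sets borel)"
    using sets.sigma_algebra_axioms[of "borel :: 'a measure"] by simp
  ultimately have "measure_space UNIV (sets borel) outer"
    using L measure_down by blast
  then show ?thesis
    unfolding riesz_def using assms by (intro emeasure_measure_of_sigma) (auto simp: measure_space_def)
qed

lemma finite_measure_riesz: "finite_measure riesz"
  by (rule finite_measureI) (simp add: emeasure_riesz outer_UNIV)

lemma measure_riesz_le: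
  assumes "A \<in> sets borel" "continuous_on UNIV g" "\<And>x. 0 \<le> g x" "\<And>x. x \<in> A \<Longrightarrow> 1 \<le> g x"
  shows "measure riesz A \<le> \<Lambda> g"
  using outer_le_single[of g A] assms nonneg[of g]
  by (simp add: measure_def emeasure_riesz enn2real_leI)

lemma measure_riesz_UNIV: "measure riesz UNIV = \<Lambda> (\<lambda>x. 1)"
  by (simp add: measure_def emeasure_riesz outer_UNIV nonneg)

lemma integrable_riesz:
  fixes g :: "'a \<Rightarrow> real"
  assumes "continuous_on UNIV g"
  shows "integrable riesz g"
proof -
  interpret finite_measure riesz by (rule finite_measure_riesz)
  obtain B where "\<And>x. \<bar>g x\<bar> \<le> B"
    using continuous_on_compact_UNIV_bounded[OF compact_UNIV assms] by blast
  then show ?thesis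
    using borel_measurable_continuous_onI[OF assms] by (intro integrable_const_bound[where B = B]) auto
qed

text \<open>Each slice \<open>min g ((j+1)\<delta>) - min g (j\<delta>)\<close> integrates to at most \<open>\<delta>\<close> times the measure
  of \<open>{g > j\<delta>}\<close>, and the preceding slice divided by \<open>\<delta>\<close> dominates the indicator of that set.\<close>

lemma integral_truncation_le:
  assumes g: "continuous_on UNIV g" "\<And>x. 0 \<le> g x" and "\<delta> > 0"
  shows "(\<integral>x. min (g x) (real (Suc j) * \<delta>) \<partial>riesz) \<le> \<delta> * \<Lambda> (\<lambda>x. 1) + \<Lambda> (\<lambda>x. min (g x) (real j * \<delta>))"
proof -
  interpret finite_measure riesz by (rule finite_measure_riesz)
  have [measurable]: "g \<in> borel_measurable borel" using g(1) by (rule borel_measurable_continuous_onI)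
  define w where "w j x = min (g x) (real j * \<delta>)" for j x
  have w_cont: "continuous_on UNIV (w j)" for j
    unfolding w_def using g(1) by (intro continuous_intros)
  have "(\<integral>x. w (Suc j) x \<partial>riesz) \<le> \<delta> * \<Lambda> (\<lambda>x. 1) + \<Lambda> (w j)"
  proof (induction j)
    case 0
    \<comment> \<open>The lowest slice has no predecessor to compare with; bounding it by
      \<open>\<delta>\<close> times the total mass produces the error term.\<close>
    have "(\<integral>x. w (Suc 0) x \<partial>riesz) \<le> (\<integral>x. \<delta> \<partial>riesz)"
      by (intro integral_mono integrable_riesz[OF w_cont]) (simp_all add: w_def)
    moreover have "w 0 = (\<lambda>x. 0)" using g(2) by (auto simp: w_def)
    ultimately show ?case by (simp add: measure_riesz_UNIV zero mult.commute)
  next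
    case (Suc j)
    let ?A = "{x. real (Suc j) * \<delta> < g x}"
    have A: "?A \<in> sets borel" by measurable
    have "(\<integral>x. w (Suc (Suc j)) x - w (Suc j) x \<partial>riesz) \<le> (\<integral>x. \<delta> * indicator ?A x \<partial>riesz)"
    proof (rule integral_mono)
      show "w (Suc (Suc j)) x - w (Suc j) x \<le> \<delta> * indicator ?A x" for x
        by (auto simp: w_def indicator_def algebra_simps)
      show "integrable riesz (\<lambda>x. \<delta> * indicator ?A x)"
        using A by (simp add: emeasure_eq_measure)
    qed (intro Bochner_Integration.integrable_diff integrable_riesz w_cont)
    also have "\<dots> = \<delta> * measure riesz ?A" by simp
    also have "measure riesz ?A \<le> \<Lambda> (\<lambda>x. (1 / \<delta>) * (w (Suc j) x - w j x))"
    proof (rule measure_riesz_le[OF A])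
      show "continuous_on UNIV (\<lambda>x. (1 / \<delta>) * (w (Suc j) x - w j x))"
        using w_cont by (intro continuous_intros)
      have "real j * \<delta> \<le> real (Suc j) * \<delta>" using \<open>\<delta> > 0\<close> by (simp add: algebra_simps)
      then show "0 \<le> (1 / \<delta>) * (w (Suc j) x - w j x)" for x
        using \<open>\<delta> > 0\<close> min.mono[of "g x" "g x"] by (simp add: w_def)
      show "1 \<le> (1 / \<delta>) * (w (Suc j) x - w j x)" if "x \<in> ?A" for x
        using that \<open>\<delta> > 0\<close> by (auto simp: w_def algebra_simps)
    qed
    also have "\<dots> = (\<Lambda> (w (Suc j)) - \<Lambda> (w j)) / \<delta>"
      using scale[of "\<lambda>x. w (Suc j) x - w j x" "1 / \<delta>"] w_cont
      by (simp add: diff continuous_intros)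
    finally have "(\<integral>x. w (Suc (Suc j)) x - w (Suc j) x \<partial>riesz) \<le> \<Lambda> (w (Suc j)) - \<Lambda> (w j)"
      using \<open>\<delta> > 0\<close> by simp
    then show ?case using Suc integrable_riesz[OF w_cont] by simp
  qed
  then show ?thesis by (simp add: w_def[abs_def])
qed

text \<open>Truncation above the bound of \<open>g\<close> changes nothing, so the truncation
  estimate bounds the integral by \<open>\<Lambda> g\<close> up to an error proportional to
  \<open>\<delta>\<close>.\<close>

lemma integral_riesz_le_nonneg:
  assumes g: "continuous_on UNIV g" "\<And>x. 0 \<le> g x"
  shows "integral\<^sup>L riesz g \<le> \<Lambda> g"
proof (rule field_le_epsilon)
  fix e :: real assume e: "e > 0"
  \<comment> \<open>The added 1 covers the case of total mass 0.\<close>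
  define \<delta> where "\<delta> = e / (\<Lambda> (\<lambda>x. 1) + 1)"
  have \<Lambda>1: "\<Lambda> (\<lambda>x. 1) \<ge> 0" by (simp add: nonneg)
  have \<delta>: "\<delta> > 0" using e \<Lambda>1 by (simp add: \<delta>_def)
  obtain B where B: "\<And>x. \<bar>g x\<bar> \<le> B"
    using continuous_on_compact_UNIV_bounded[OF compact_UNIV g(1)] by blast
  obtain n where n: "B < real n * \<delta>" using reals_Archimedean3[OF \<delta>] by blast
  have *: "min (g x) (real (Suc n) * \<delta>) = g x" "min (g x) (real n * \<delta>) = g x" for x
    using B[of x] n \<delta> by (auto simp: algebra_simps)
  have "integral\<^sup>L riesz g \<le> \<delta> * \<Lambda> (\<lambda>x. 1) + \<Lambda> g"
    using integral_truncation_le[OF g \<delta>, of n] by (simp only: *)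
  also have "\<delta> * \<Lambda> (\<lambda>x. 1) \<le> e"
    using e \<Lambda>1 by (simp add: \<delta>_def field_simps)
  finally show "integral\<^sup>L riesz g \<le> \<Lambda> g + e" by simp
qed

text \<open>Adding a constant makes \<open>g\<close> nonnegative, and constants integrate exactly
  because the total mass of \<open>riesz\<close> is \<open>\<Lambda>\<close> of 1.\<close>

lemma integral_riesz_le:
  assumes g: "continuous_on UNIV g"
  shows "integral\<^sup>L riesz g \<le> \<Lambda> g"
proof -
  interpret finite_measure riesz by (rule finite_measure_riesz)
  obtain B where B: "\<And>x. \<bar>g x\<bar> \<le> B"
    using continuous_on_compact_UNIV_bounded[OF compact_UNIV g] by blast
  have "0 \<le> g x + B" for x using B[of x] by linarith
  then have "integral\<^sup>L riesz (\<lambda>x. g x + B) \<le> \<Lambda> (\<lambda>x. g x + B)"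
    using g by (intro integral_riesz_le_nonneg continuous_intros)
  moreover have "\<Lambda> (\<lambda>x. g x + B) = \<Lambda> g + B * \<Lambda> (\<lambda>x. 1)"
    using add[OF g, of "\<lambda>x. B"] by (simp add: const[of B])
  ultimately show ?thesis using integrable_riesz[OF g] by (simp add: measure_riesz_UNIV)
qed

theorem integral_riesz:
  assumes g: "continuous_on UNIV g"
  shows "integral\<^sup>L riesz g = \<Lambda> g"
proof (rule antisym)
  \<comment> \<open>The one-sided bound for \<open>- g\<close> is the missing inequality for
    \<open>g\<close>.\<close>
  have "continuous_on UNIV (\<lambda>x. (- 1) * g x)" using g by (intro continuous_intros)
  from integral_riesz_le[OF this] show "\<Lambda> g \<le> integral\<^sup>L riesz g" using scale[OF g, of "- 1"] by simp
qed (rule integral_riesz_le[OF g])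

end

section \<open>Invariant measures\<close>

lemma inv_measD:
  assumes "M \<in> inv_meas T"
  shows "sets M = sets borel" "prob_space M" "distr M borel T = M"
  using assms by (auto simp: inv_meas_def)

lemma measure_preserving_inv_meas:
  assumes "M \<in> inv_meas T" "continuous_on UNIV T"
  shows "measure_preserving M T"
proof -
  note M = inv_measD[OF assms(1)]
  interpret prob_space M by (rule M(2))
  have "distr M M T = distr M borel T" by (rule distr_cong) (auto simp: M(1))
  moreover have "T \<in> measurable M M"
    using borel_measurable_continuous_onI[OF assms(2)] measurable_cong_sets[OF M(1) M(1)] by blast
  ultimately show ?thesis using M(3) by unfold_locales auto
qed

text \<open>Adding coboundaries to the argument of \<open>P\<close> and taking the infimum makes a dominated linear
  functional invariant; one that attains the bound at \<open>- f\<close> then makes the integral of \<open>f\<close>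
  the supremum of \<open>- P (k - k \<circ> T - f)\<close> over continuous \<open>k\<close>.\<close>

theorem invariant_measure_dominated:
  fixes T :: "'a::metric_space \<Rightarrow> 'a" and P :: "('a \<Rightarrow> real) \<Rightarrow> real"
  assumes compact: "compact (UNIV :: 'a set)" and T: "continuous_on UNIV T"
    and P_add: "\<And>f g. continuous_on UNIV f \<Longrightarrow> continuous_on UNIV g \<Longrightarrow> P (\<lambda>x. f x + g x) \<le> P f + P g"
    and P_scale: "\<And>c f. c > 0 \<Longrightarrow> continuous_on UNIV f \<Longrightarrow> P (\<lambda>x. c * f x) \<le> c * P f"
    and P_le: "\<And>c f. continuous_on UNIV f \<Longrightarrow> (\<And>x. f x \<le> c) \<Longrightarrow> P f \<le> c"
    and P_coboundary: "\<And>k. continuous_on UNIV k \<Longrightarrow> 0 \<le> P (\<lambda>x. k x - k (T x))"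
    and f: "continuous_on UNIV f"
  shows "\<exists>M\<in>inv_meas T. (\<forall>g. continuous_on UNIV g \<longrightarrow> integral\<^sup>L M g \<le> P g) \<and>
    (\<forall>c < integral\<^sup>L M f. \<exists>k. continuous_on UNIV k \<and> P (\<lambda>x. k x - k (T x) - f x) < - c)"
proof -
  have contT: "continuous_on UNIV (\<lambda>x. g (T x))" if "continuous_on UNIV g" for g :: "'a \<Rightarrow> real"
    using continuous_on_compose2[OF that T] by simp
  \<comment> \<open>Hahn-Banach is applied on the vector space of bounded continuous functions,
    which by compactness contains every continuous function.\<close>
  have bcont: "apply_bcontfun (Bcontfun g) = g" if g: "continuous_on UNIV g" for g :: "'a \<Rightarrow> real"
  proof (rule Bcontfun_inverse)
    obtain B where "\<And>x. \<bar>g x\<bar> \<le> B"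
      using continuous_on_compact_UNIV_bounded[OF compact g] by blast
    with g show "g \<in> bcontfun" by (intro bcontfun_normI[where b = B]) simp_all
  qed
  define Q where "Q g k = P (\<lambda>x. apply_bcontfun g x + (apply_bcontfun k x - apply_bcontfun k (T x)))" for g k
  define p where "p g = (INF k. Q g k)" for g
  have cob: "continuous_on UNIV (\<lambda>x. apply_bcontfun k x - apply_bcontfun k (T x))" for k :: "'a \<Rightarrow>\<^sub>C real"
    by (intro continuous_on_diff contT) auto
  have cobQ: "continuous_on UNIV (\<lambda>x. apply_bcontfun g x + (apply_bcontfun k x - apply_bcontfun k (T x)))"
    for g k :: "'a \<Rightarrow>\<^sub>C real"
    by (intro continuous_on_add cob) auto
  have bdd: "bdd_below (range (Q g))" for g
  proof (rule bdd_belowI2)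
    fix k
    \<comment> \<open>A coboundary is itself plus \<open>g\<close> minus \<open>g\<close>, so
      subadditivity yields a bound independent of \<open>k\<close>.\<close>
    have "0 \<le> P (\<lambda>x. apply_bcontfun k x - apply_bcontfun k (T x))"
      by (rule P_coboundary) simp
    also have "\<dots> = P (\<lambda>x. (apply_bcontfun g x + (apply_bcontfun k x - apply_bcontfun k (T x)))
        + - apply_bcontfun g x)" by simp
    also have "\<dots> \<le> Q g k + P (\<lambda>x. - apply_bcontfun g x)"
      unfolding Q_def by (intro P_add cobQ continuous_on_minus) simp
    finally show "- P (\<lambda>x. - apply_bcontfun g x) \<le> Q g k" by simp
  qed
  have p_le: "p g \<le> Q g k" for g k
    unfolding p_def by (intro cINF_lower bdd) simp
  have "sublinear p"
  proof (rule sublinearI)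
    fix g h
    have "p (g + h) - Q h l \<le> Q g k" for k l
    proof -
      have "p (g + h) \<le> Q (g + h) (k + l)" by (rule p_le)
      also have "\<dots> = P (\<lambda>x. (apply_bcontfun g x + (apply_bcontfun k x - apply_bcontfun k (T x)))
         + (apply_bcontfun h x + (apply_bcontfun l x - apply_bcontfun l (T x))))"
        unfolding Q_def by (simp add: algebra_simps)
      also have "\<dots> \<le> Q g k + Q h l" unfolding Q_def by (intro P_add cobQ)
      finally show ?thesis by simp
    qed
    then have "p (g + h) - Q h l \<le> p g" for l
      unfolding p_def[of g] by (intro cINF_greatest) auto
    then have "p (g + h) - p g \<le> Q h l" for l by (simp add: algebra_simps)
    then have "p (g + h) - p g \<le> p h"
      unfolding p_def[of h] by (intro cINF_greatest) auto
    then show "p (g + h) \<le> p g + p h" by simp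
  next
    fix c :: real and g assume c: "c > 0"
    have "p (c *\<^sub>R g) / c \<le> Q g k" for k
    proof -
      have "p (c *\<^sub>R g) \<le> Q (c *\<^sub>R g) (c *\<^sub>R k)" by (rule p_le)
      also have "\<dots> = P (\<lambda>x. c * (apply_bcontfun g x + (apply_bcontfun k x - apply_bcontfun k (T x))))"
        unfolding Q_def by (simp add: algebra_simps)
      also have "\<dots> \<le> c * Q g k" unfolding Q_def by (intro P_scale cobQ c)
      finally show ?thesis using c by (simp add: field_simps)
    qed
    then have "p (c *\<^sub>R g) / c \<le> p g"
      unfolding p_def[of g] by (intro cINF_greatest) auto
    then show "p (c *\<^sub>R g) \<le> c * p g" using c by (simp add: field_simps)
  qed
  then obtain \<phi> where \<phi>: "linear \<phi>" "\<phi> \<le> p" "\<phi> (Bcontfun (\<lambda>x. - f x)) = p (Bcontfun (\<lambda>x. - f x))"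
    using linear_below_sublinear by blast
  define \<Lambda> where "\<Lambda> g = \<phi> (Bcontfun g)" for g
  have \<Lambda>_le_p: "\<Lambda> g \<le> p (Bcontfun g)" for g using \<phi>(2) by (simp add: \<Lambda>_def le_fun_def)
  have \<Lambda>_le: "\<Lambda> g \<le> P g" if g: "continuous_on UNIV g" for g
  proof -
    have "\<Lambda> g \<le> Q (Bcontfun g) 0" using \<Lambda>_le_p p_le by (rule order_trans)
    then show ?thesis by (simp add: Q_def bcont[OF g])
  qed
  have \<Lambda>_add: "\<Lambda> (\<lambda>x. g x + h x) = \<Lambda> g + \<Lambda> h" if "continuous_on UNIV g" "continuous_on UNIV h" for g h
  proof -
    have "Bcontfun (\<lambda>x. g x + h x) = Bcontfun g + Bcontfun h"
      using that by (intro bcontfun_eqI) (simp add: bcont continuous_on_add)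
    then show ?thesis by (simp add: \<Lambda>_def linear_add[OF \<phi>(1)])
  qed
  have \<Lambda>_scale: "\<Lambda> (\<lambda>x. c * g x) = c * \<Lambda> g" if "continuous_on UNIV g" for c g
  proof -
    have "Bcontfun (\<lambda>x. c * g x) = c *\<^sub>R Bcontfun g"
      using that by (intro bcontfun_eqI) (simp add: bcont continuous_on_mult_left)
    then show ?thesis by (simp add: \<Lambda>_def linear_cmul[OF \<phi>(1)])
  qed
  have \<Lambda>_minus: "\<Lambda> (\<lambda>x. - g x) = - \<Lambda> g" if "continuous_on UNIV g" for g
    using \<Lambda>_scale[OF that, of "- 1"] by simp
  interpret positive_functional \<Lambda>
  proof
    fix g :: "'a \<Rightarrow> real" assume g: "continuous_on UNIV g" "\<And>x. 0 \<le> g x"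
    \<comment> \<open>Domination gives upper bounds only, so positivity is tested at
      \<open>- g\<close>.\<close>
    then have "P (\<lambda>x. - g x) \<le> 0" by (intro P_le continuous_on_minus) auto
    then show "0 \<le> \<Lambda> g"
      using \<Lambda>_le[of "\<lambda>x. - g x"] \<Lambda>_minus[OF g(1)] g(1) by (simp add: continuous_on_minus)
  qed (fact compact \<Lambda>_add \<Lambda>_scale)+
  have \<Lambda>1: "\<Lambda> (\<lambda>x. 1) = 1"
  proof (rule antisym)
    have "\<Lambda> (\<lambda>x. 1) \<le> P (\<lambda>x. 1)" by (rule \<Lambda>_le) simp
    also have "\<dots> \<le> 1" by (rule P_le) auto
    finally show "\<Lambda> (\<lambda>x. 1) \<le> 1" .
    have "\<Lambda> (\<lambda>x. - 1) \<le> P (\<lambda>x. - 1)" by (rule \<Lambda>_le) simp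
    also have "\<dots> \<le> - 1" by (rule P_le) auto
    finally show "1 \<le> \<Lambda> (\<lambda>x. 1)" using \<Lambda>_minus[of "\<lambda>x. 1"] by simp
  qed
  have \<Lambda>_coboundary: "\<Lambda> (\<lambda>x. g x - g (T x)) \<le> 0" if g: "continuous_on UNIV g" for g
  proof -
    have g': "continuous_on UNIV (\<lambda>x. g x - g (T x))" "continuous_on UNIV (\<lambda>x. - g x)"
      using g contT by (auto intro: continuous_on_diff continuous_on_minus)
    \<comment> \<open>Choosing \<open>- g\<close> as the free function in the infimum cancels the
      coboundary. Applied to \<open>- g\<close> as well, this gives invariance.\<close>
    have "\<Lambda> (\<lambda>x. g x - g (T x)) \<le> Q (Bcontfun (\<lambda>x. g x - g (T x))) (Bcontfun (\<lambda>x. - g x))"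
      using \<Lambda>_le_p p_le by (rule order_trans)
    also have "\<dots> = P (\<lambda>x. 0)" by (simp add: Q_def bcont[OF g'(1)] bcont[OF g'(2)])
    also have "\<dots> \<le> 0" by (rule P_le) auto
    finally show ?thesis .
  qed
  have \<Lambda>_invariant: "\<Lambda> (\<lambda>x. g (T x)) = \<Lambda> g" if g: "continuous_on UNIV g" for g
  proof -
    have "\<Lambda> (\<lambda>x. - g x - - g (T x)) \<le> 0"
      using g by (intro \<Lambda>_coboundary continuous_on_minus)
    moreover have "\<Lambda> (\<lambda>x. - g x - - g (T x)) = \<Lambda> (\<lambda>x. g (T x)) - \<Lambda> g"
      using diff[OF contT[OF g] g] by (simp add: algebra_simps)
    ultimately show ?thesis using \<Lambda>_coboundary[OF g] diff[OF g contT[OF g]] by simp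
  qed
  have prob: "prob_space riesz"
    by (rule prob_spaceI) (simp add: emeasure_riesz outer_UNIV \<Lambda>1)
  have T_meas: "T \<in> measurable riesz borel"
    using borel_measurable_continuous_onI[OF T] by (simp cong: measurable_cong_sets)
  have "distr riesz borel T = riesz"
  proof (rule measure_eqI_continuous)
    show "finite_measure (distr riesz borel T)"
      using prob_space.prob_space_distr[OF prob T_meas] by (rule prob_space.finite_measure)
    fix g :: "'a \<Rightarrow> real" assume g: "continuous_on UNIV g"
    have "integral\<^sup>L (distr riesz borel T) g = (\<integral>x. g (T x) \<partial>riesz)"
      by (rule integral_distr[OF T_meas borel_measurable_continuous_onI[OF g]])
    then show "integral\<^sup>L (distr riesz borel T) g = integral\<^sup>L riesz g"
      by (simp add: integral_riesz g contT \<Lambda>_invariant)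
  qed (simp_all add: finite_measure_riesz)
  then have "riesz \<in> inv_meas T" by (simp add: inv_meas_def prob)
  moreover have "integral\<^sup>L riesz g \<le> P g" if "continuous_on UNIV g" for g
    using \<Lambda>_le[OF that] integral_riesz[OF that] by simp
  moreover have "\<exists>k. continuous_on UNIV k \<and> P (\<lambda>x. k x - k (T x) - f x) < - c" if c: "c < integral\<^sup>L riesz f" for c
  proof -
    \<comment> \<open>As \<open>\<phi>\<close> equals \<open>p\<close> at \<open>- f\<close>, a
      strict bound on the integral of \<open>f\<close> is one on the infimum \<open>p\<close>, and
      some \<open>k\<close> witnesses it.\<close>
    have "p (Bcontfun (\<lambda>x. - f x)) < - c"
      using c \<phi>(3) \<Lambda>_minus[OF f] integral_riesz[OF f] by (simp add: \<Lambda>_def)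
    then obtain k where "Q (Bcontfun (\<lambda>x. - f x)) k < - c"
      unfolding p_def using cINF_less_iff[OF _ bdd] by auto
    then have "P (\<lambda>x. apply_bcontfun k x - apply_bcontfun k (T x) - f x) < - c"
      using bcont[OF continuous_on_minus[OF f]] by (simp add: Q_def)
    then show ?thesis by (intro exI[of _ "apply_bcontfun k"]) simp
  qed
  ultimately show ?thesis by blast
qed

text \<open>The dominating functional is the supremum over the space: at a maximum of
  \<open>k\<close> the coboundary \<open>k - k \<circ> T\<close> is nonnegative. Nonemptiness gives
  meaning to the real supremum in \<open>alpha\<close>.\<close>

corollary inv_meas_nonempty:
  fixes T :: "'a::metric_space \<Rightarrow> 'a"
  assumes "compact (UNIV :: 'a set)" and "continuous_on UNIV T"
  shows "inv_meas T \<noteq> {}"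
proof -
  have bdd: "bdd_above (range g)" if "continuous_on UNIV g" for g :: "'a \<Rightarrow> real"
    using compact_imp_bounded[OF compact_continuous_image[OF that assms(1)]]
    by (rule bounded_imp_bdd_above)
  have "\<exists>M\<in>inv_meas T. (\<forall>g. continuous_on UNIV g \<longrightarrow> integral\<^sup>L M g \<le> (SUP x. g x :: real)) \<and>
    (\<forall>c < integral\<^sup>L M (\<lambda>x. 0). \<exists>k. continuous_on UNIV k \<and> (SUP x. k x - k (T x) - 0 :: real) < - c)"
  proof (rule invariant_measure_dominated[where P = "\<lambda>g. SUP x. g x", OF assms])
    fix f g :: "'a \<Rightarrow> real" assume "continuous_on UNIV f" "continuous_on UNIV g"
    then show "(SUP x. f x + g x) \<le> (SUP x. f x) + (SUP x. g x)"
      by (intro cSUP_least add_mono cSUP_upper bdd) auto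
  next
    fix c :: real and f :: "'a \<Rightarrow> real" assume "c > 0" "continuous_on UNIV f"
    then show "(SUP x. c * f x) \<le> c * (SUP x. f x)"
      by (intro cSUP_least mult_left_mono cSUP_upper bdd) auto
  next
    fix k :: "'a \<Rightarrow> real" assume k: "continuous_on UNIV k"
    obtain z where z: "\<And>x. k x \<le> k z"
      using continuous_attains_sup[OF assms(1) _ k] by auto
    have "continuous_on UNIV (\<lambda>x. k x - k (T x))"
      using k continuous_on_compose2[OF k assms(2)] by (intro continuous_on_diff) auto
    then have "k z - k (T z) \<le> (SUP x. k x - k (T x))" by (intro cSUP_upper bdd) auto
    with z[of "T z"] show "0 \<le> (SUP x. k x - k (T x))" by simp
  qed (auto intro: cSUP_least)
  then show ?thesis by blast
qed

section \<open>Open factor maps\<close>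

locale open_factor =
  fixes U :: "'z::metric_space \<Rightarrow> 'z" and S :: "'y::metric_space \<Rightarrow> 'y" and \<pi> :: "'z \<Rightarrow> 'y"
  assumes compact_Z: "compact (UNIV :: 'z set)"
    and cont_U: "continuous_on UNIV U" and cont_S: "continuous_on UNIV S" and cont_\<pi>: "continuous_on UNIV \<pi>"
    and surj: "surj \<pi>" and equivariant: "\<pi> (U z) = S (\<pi> z)" and open_map: "open A \<Longrightarrow> open (\<pi> ` A)"
begin

section \<open>Fiberwise suprema\<close>

definition fiber_sup :: "('z \<Rightarrow> real) \<Rightarrow> 'y \<Rightarrow> real" where
  "fiber_sup g y = (SUP z\<in>\<pi> -` {y}. g z)"

lemma fiber_nonempty: "\<pi> -` {y} \<noteq> {}"
  using surj by (metis surj_def vimage_singleton_eq empty_iff)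

lemma bdd_above_image: "continuous_on UNIV g \<Longrightarrow> bdd_above (g ` A)" for g :: "'z \<Rightarrow> real"
  using compact_imp_bounded[OF compact_continuous_image[OF _ compact_Z]]
  by (meson bdd_above_mono bounded_imp_bdd_above image_mono subset_UNIV)

lemma le_fiber_sup: "continuous_on UNIV g \<Longrightarrow> g z \<le> fiber_sup g (\<pi> z)"
  unfolding fiber_sup_def by (intro cSUP_upper bdd_above_image) auto

lemma fiber_sup_le: "(\<And>z. \<pi> z = y \<Longrightarrow> g z \<le> c) \<Longrightarrow> fiber_sup g y \<le> c"
  unfolding fiber_sup_def using fiber_nonempty by (intro cSUP_least) auto

text \<open>The only use of the openness of \<open>\<pi>\<close>.\<close>

lemma fiber_sup_measurable:
  assumes g: "continuous_on UNIV g"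
  shows "fiber_sup g \<in> borel_measurable borel"
proof (rule borel_measurableI_greater)
  fix t
  have "{y \<in> space borel. t < fiber_sup g y} = \<pi> ` {z. t < g z}"
    unfolding fiber_sup_def using fiber_nonempty bdd_above_image[OF g]
    by (auto simp: less_cSUP_iff)
  moreover have "open {z. t < g z}" using g by (intro open_Collect_less continuous_intros)
  ultimately show "{y \<in> space borel. t < fiber_sup g y} \<in> sets borel"
    using open_map by simp
qed

lemma fiber_sup_bounded:
  assumes "continuous_on UNIV g"
  shows "\<exists>B. \<forall>y. \<bar>fiber_sup g y\<bar> \<le> B"
proof -
  obtain B where B: "\<And>z. \<bar>g z\<bar> \<le> B"
    using continuous_on_compact_UNIV_bounded[OF compact_Z assms] by blast
  have "\<bar>fiber_sup g y\<bar> \<le> B" for y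
  proof -
    obtain z where "\<pi> z = y" using surj by (metis surj_def)
    then have "g z \<le> fiber_sup g y" using le_fiber_sup[OF assms, of z] by simp
    moreover have "fiber_sup g y \<le> B"
    proof (rule fiber_sup_le)
      show "g z \<le> B" for z using B[of z] by simp
    qed
    ultimately show ?thesis using B[of z] by simp
  qed
  then show ?thesis by blast
qed

lemma integrable_fiber_sup:
  assumes "\<nu> \<in> inv_meas S" "continuous_on UNIV g"
  shows "integrable \<nu> (fiber_sup g)"
proof -
  interpret measure_preserving \<nu> S
    using assms(1) cont_S by (rule measure_preserving_inv_meas)
  obtain B where "\<And>y. \<bar>fiber_sup g y\<bar> \<le> B" using fiber_sup_bounded[OF assms(2)] by blast
  moreover have "fiber_sup g \<in> borel_measurable \<nu>"
    using fiber_sup_measurable[OF assms(2)] inv_measD(1)[OF assms(1)] by (simp cong: measurable_cong_sets)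
  ultimately show ?thesis by (intro integrable_of_bounded)
qed

text \<open>The dominating functional is the \<open>\<nu>\<close>-integral of the fiberwise
  supremum. On functions \<open>h \<circ> \<pi>\<close> it is the integral of \<open>h\<close>;
  domination at \<open>h\<close> and at \<open>- h\<close> forces the image measure to be
  \<open>\<nu>\<close>.\<close>

theorem lift_invariant_measure:
  assumes \<nu>: "\<nu> \<in> inv_meas S" and f: "continuous_on UNIV f"
  shows "\<exists>M\<in>inv_meas U. distr M borel \<pi> = \<nu> \<and>
    (\<forall>c < integral\<^sup>L M f. \<exists>k. continuous_on UNIV k \<and> (\<integral>y. fiber_sup (\<lambda>z. k z - k (U z) - f z) y \<partial>\<nu>) < - c)"
proof -
  interpret \<nu>: measure_preserving \<nu> S
    using \<nu> cont_S by (rule measure_preserving_inv_meas)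
  note int = integrable_fiber_sup[OF \<nu>]
  have "\<exists>M\<in>inv_meas U. (\<forall>g. continuous_on UNIV g \<longrightarrow> integral\<^sup>L M g \<le> integral\<^sup>L \<nu> (fiber_sup g)) \<and>
    (\<forall>c < integral\<^sup>L M f. \<exists>k. continuous_on UNIV k \<and> integral\<^sup>L \<nu> (fiber_sup (\<lambda>z. k z - k (U z) - f z)) < - c)"
  proof (rule invariant_measure_dominated[OF compact_Z cont_U _ _ _ _ f])
    fix g h :: "'z \<Rightarrow> real" assume gh: "continuous_on UNIV g" "continuous_on UNIV h"
    have "integral\<^sup>L \<nu> (fiber_sup (\<lambda>x. g x + h x)) \<le> (\<integral>y. fiber_sup g y + fiber_sup h y \<partial>\<nu>)"
      using gh by (intro integral_mono int Bochner_Integration.integrable_add continuous_on_add fiber_sup_le)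
        (auto intro!: add_mono le_fiber_sup)
    then show "integral\<^sup>L \<nu> (fiber_sup (\<lambda>x. g x + h x)) \<le> integral\<^sup>L \<nu> (fiber_sup g) + integral\<^sup>L \<nu> (fiber_sup h)"
      using int gh by simp
  next
    fix c :: real and g :: "'z \<Rightarrow> real" assume c: "c > 0" and g: "continuous_on UNIV g"
    have "integral\<^sup>L \<nu> (fiber_sup (\<lambda>x. c * g x)) \<le> (\<integral>y. c * fiber_sup g y \<partial>\<nu>)"
      using g c by (intro integral_mono int integrable_mult_right continuous_on_mult_left fiber_sup_le)
        (auto intro!: mult_left_mono le_fiber_sup)
    then show "integral\<^sup>L \<nu> (fiber_sup (\<lambda>x. c * g x)) \<le> c * integral\<^sup>L \<nu> (fiber_sup g)" by simp
  next
    fix c :: real and g :: "'z \<Rightarrow> real" assume g: "continuous_on UNIV g" "\<And>x. g x \<le> c"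
    have "integral\<^sup>L \<nu> (fiber_sup g) \<le> (\<integral>y. c \<partial>\<nu>)"
      using g by (intro integral_mono int fiber_sup_le) auto
    then show "integral\<^sup>L \<nu> (fiber_sup g) \<le> c" by (simp add: \<nu>.prob_space)
  next
    fix k :: "'z \<Rightarrow> real" assume k: "continuous_on UNIV k"
    let ?k = "\<lambda>x. k x - k (U x)"
    have k': "continuous_on UNIV ?k"
      using k continuous_on_compose2[OF k cont_U] by (intro continuous_on_diff) auto
    have meas: "fiber_sup k \<in> borel_measurable \<nu>" using int[OF k] by simp
    have int_S: "integrable \<nu> (\<lambda>y. fiber_sup k (S y))"
    proof -
      obtain B where "\<And>y. \<bar>fiber_sup k y\<bar> \<le> B" using fiber_sup_bounded[OF k] by blast
      then show ?thesis
        using measurable_compose[OF \<nu>.T_measurable meas] by (intro \<nu>.integrable_of_bounded)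
    qed
    \<comment> \<open>\<open>U\<close> maps the fiber over \<open>y\<close> into the fiber over
      \<open>S y\<close>; after integration the two integrals of \<open>fiber_sup k\<close> cancel
      by invariance of \<open>\<nu>\<close>.\<close>
    have "integral\<^sup>L \<nu> (fiber_sup k) \<le> (\<integral>y. fiber_sup ?k y + fiber_sup k (S y) \<partial>\<nu>)"
    proof (intro integral_mono int k k' Bochner_Integration.integrable_add int_S)
      fix y
      show "fiber_sup k y \<le> fiber_sup ?k y + fiber_sup k (S y)"
      proof (rule fiber_sup_le)
        fix z assume z: "\<pi> z = y"
        show "k z \<le> fiber_sup ?k y + fiber_sup k (S y)"
          using le_fiber_sup[OF k', of z] le_fiber_sup[OF k, of "U z"] by (simp add: z equivariant)
      qed
    qed
    also have "\<dots> = integral\<^sup>L \<nu> (fiber_sup ?k) + integral\<^sup>L \<nu> (fiber_sup k)"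
      using int[OF k'] int_S by (simp add: \<nu>.integral_comp_T[OF meas])
    finally show "0 \<le> integral\<^sup>L \<nu> (fiber_sup ?k)" by simp
  qed
  then obtain M where M: "M \<in> inv_meas U"
    and le: "\<And>g. continuous_on UNIV g \<Longrightarrow> integral\<^sup>L M g \<le> integral\<^sup>L \<nu> (fiber_sup g)"
    and attained: "\<forall>c < integral\<^sup>L M f. \<exists>k. continuous_on UNIV k \<and> integral\<^sup>L \<nu> (fiber_sup (\<lambda>z. k z - k (U z) - f z)) < - c"
    by blast
  note sets_\<nu> = inv_measD(1)[OF \<nu>] and sets_M = inv_measD(1)[OF M]
  have \<pi>_meas: "\<pi> \<in> measurable M borel"
    using borel_measurable_continuous_onI[OF cont_\<pi>] sets_M by (simp cong: measurable_cong_sets)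
  have le': "(\<integral>z. h (\<pi> z) \<partial>M) \<le> integral\<^sup>L \<nu> h" if h: "continuous_on UNIV h" "\<And>y. \<bar>h y\<bar> \<le> 1"
    for h :: "'y \<Rightarrow> real"
  proof -
    have h': "continuous_on UNIV (\<lambda>z. h (\<pi> z))" using continuous_on_compose2[OF h(1) cont_\<pi>] by simp
    have "h \<in> borel_measurable \<nu>"
      using borel_measurable_continuous_onI[OF h(1)] sets_\<nu> by (simp cong: measurable_cong_sets)
    then have "integrable \<nu> h" by (rule \<nu>.integrable_of_bounded[OF _ h(2)])
    then have "integral\<^sup>L \<nu> (fiber_sup (\<lambda>z. h (\<pi> z))) \<le> integral\<^sup>L \<nu> h"
      using int[OF h'] by (intro integral_mono fiber_sup_le) auto
    then show ?thesis using le[OF h'] by simp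
  qed
  have "distr M borel \<pi> = \<nu>"
  proof (rule measure_eqI_continuous)
    show "finite_measure (distr M borel \<pi>)"
      using prob_space.prob_space_distr[OF inv_measD(2)[OF M] \<pi>_meas] by (rule prob_space.finite_measure)
    fix h :: "'y \<Rightarrow> real" assume h: "continuous_on UNIV h" "\<And>y. \<bar>h y\<bar> \<le> 1"
    have "integral\<^sup>L (distr M borel \<pi>) h = (\<integral>z. h (\<pi> z) \<partial>M)"
      by (rule integral_distr[OF \<pi>_meas borel_measurable_continuous_onI[OF h(1)]])
    moreover have "(\<integral>z. - h (\<pi> z) \<partial>M) \<le> (\<integral>y. - h y \<partial>\<nu>)"
      using h by (intro le' continuous_on_minus) auto
    ultimately show "integral\<^sup>L (distr M borel \<pi>) h = integral\<^sup>L \<nu> h"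
      using le'[OF h] by simp
  qed (use sets_\<nu> \<nu>.finite_measure in auto)
  with M attained show ?thesis by blast
qed

text \<open>The value \<open>\<psi>\<close> is at most the integral of \<open>f\<close> for the
  lifted measure, so the lift supplies a coboundary whose fiberwise correction keeps the integral
  above \<open>c\<close>.\<close>

lemma fiber_point_bounded_below:
  assumes \<nu>: "\<nu> \<in> inv_meas S" and f: "continuous_on UNIV f" and c: "c < psi U \<pi> f \<nu>"
  shows "\<exists>y\<in>\<pi> ` regular_set U f. \<forall>z\<in>regular_set U f \<inter> \<pi> -` {y}. c \<le> lim (birkhoff_avg U f z)"
proof -
  obtain B where B: "\<And>z. \<bar>f z\<bar> \<le> B"
    using continuous_on_compact_UNIV_bounded[OF compact_Z f] by blast
  obtain M where M: "M \<in> inv_meas U" and M\<nu>: "distr M borel \<pi> = \<nu>"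
    and attained: "\<And>c. c < integral\<^sup>L M f \<Longrightarrow>
      \<exists>k. continuous_on UNIV k \<and> (\<integral>y. fiber_sup (\<lambda>z. k z - k (U z) - f z) y \<partial>\<nu>) < - c"
    using lift_invariant_measure[OF \<nu> f] by blast
  interpret measure_preserving M U
    using M cont_U by (rule measure_preserving_inv_meas)
  note sets_M = inv_measD(1)[OF M]
  have f_meas: "f \<in> borel_measurable N" if "sets N = sets borel" for N
    using borel_measurable_continuous_onI[OF f] that by (simp cong: measurable_cong_sets)
  \<comment> \<open>The lift competes in the infimum; the bound \<open>- B\<close> is what makes the
    real \<open>Inf\<close> a lower bound.\<close>
  have "psi U \<pi> f \<nu> \<le> integral\<^sup>L M f"
    unfolding psi_def
  proof (rule cInf_lower)
    show "bdd_below {integral\<^sup>L m f | m. m \<in> inv_meas U \<and> distr m borel \<pi> = \<nu>}"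
    proof (rule bdd_belowI)
      fix r assume "r \<in> {integral\<^sup>L m f | m. m \<in> inv_meas U \<and> distr m borel \<pi> = \<nu>}"
      then obtain m where m: "m \<in> inv_meas U" "r = integral\<^sup>L m f" by blast
      interpret m: prob_space m by (rule inv_measD(2)[OF m(1)])
      have "integrable m f"
        using B f_meas[OF inv_measD(1)[OF m(1)]] by (intro m.integrable_const_bound[where B = B]) auto
      moreover have "- B \<le> f z" for z using B[of z] by linarith
      ultimately have "(\<integral>z. - B \<partial>m) \<le> integral\<^sup>L m f" by (intro integral_mono) auto
      then show "- B \<le> r" by (simp add: m m.prob_space)
    qed
  qed (use M M\<nu> in blast)
  with c have "c < integral\<^sup>L M f" by simp
  from attained[OF this] obtain k where k: "continuous_on UNIV k"
    and less: "(\<integral>y. fiber_sup (\<lambda>z. k z - k (U z) - f z) y \<partial>\<nu>) < - c"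
    by blast
  define h where "h = (\<lambda>z. k z - k (U z) - f z)"
  have h: "continuous_on UNIV h"
    unfolding h_def using k f continuous_on_compose2[OF k cont_U] by (intro continuous_on_diff) auto
  \<comment> \<open>The fiberwise infimum of \<open>f - k + k \<circ> U\<close>, expressed through
    \<open>fiber_sup\<close> to inherit its measurability and bounds.\<close>
  define G where "G y = - fiber_sup h y" for y
  have G_meas: "G \<in> borel_measurable borel"
    unfolding G_def[abs_def] using fiber_sup_measurable[OF h] by simp
  have \<pi>_meas: "\<pi> \<in> measurable M borel"
    using borel_measurable_continuous_onI[OF cont_\<pi>] sets_M by (simp cong: measurable_cong_sets)
  obtain D where D: "\<And>y. \<bar>fiber_sup h y\<bar> \<le> D" using fiber_sup_bounded[OF h] by blast
  have "c < (\<integral>y. G y \<partial>\<nu>)" using less by (simp add: G_def h_def)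
  also have "\<dots> = (\<integral>z. G (\<pi> z) \<partial>M)"
    unfolding M\<nu>[symmetric] by (rule integral_distr[OF \<pi>_meas G_meas])
  finally have c_less: "c < (\<integral>z. G (\<pi> z) \<partial>M)" .
  \<comment> \<open>The ergodic theorem is used on the total space, not the base, so that the same
    point is also regular for \<open>f\<close>.\<close>
  have "\<exists>z. convergent (birkhoff_avg U f z) \<and> convergent (birkhoff_avg U (\<lambda>z. G (\<pi> z)) z) \<and>
      c < lim (birkhoff_avg U (\<lambda>z. G (\<pi> z)) z)"
  proof (rule exists_lim_birkhoff_avg_gt[where B = D])
    show "(\<lambda>z. G (\<pi> z)) \<in> borel_measurable M" using \<pi>_meas G_meas by (rule measurable_compose)
    show "\<bar>G (\<pi> z)\<bar> \<le> D" for z using D by (simp add: G_def)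
    show "AE z in M. convergent (birkhoff_avg U f z)"
      using f_meas[OF sets_M] B by (rule birkhoff_AE_convergent)
  qed (fact c_less)
  then obtain z where z: "z \<in> regular_set U f" "convergent (birkhoff_avg U (\<lambda>z. G (\<pi> z)) z)"
    and c_lim: "c < lim (birkhoff_avg U (\<lambda>z. G (\<pi> z)) z)" by (auto simp: regular_set_def)
  have "c \<le> lim (birkhoff_avg U f w)" if w: "w \<in> regular_set U f" "\<pi> w = \<pi> z" for w
  proof -
    have \<pi>_funpow: "\<pi> ((U ^^ j) v) = (S ^^ j) (\<pi> v)" for j v
      by (induction j) (simp_all add: equivariant)
    have G_lim: "birkhoff_avg U (\<lambda>z. G (\<pi> z)) w \<longlonglongrightarrow> lim (birkhoff_avg U (\<lambda>z. G (\<pi> z)) z)"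
    proof -
      \<comment> \<open>Averages of \<open>G \<circ> \<pi>\<close> depend only on the base
        point.\<close>
      have "birkhoff_avg U (\<lambda>z. G (\<pi> z)) w = birkhoff_avg U (\<lambda>z. G (\<pi> z)) z"
        by (simp add: fun_eq_iff birkhoff_avg_def \<pi>_funpow w(2))
      with z(2) show ?thesis by (simp add: convergent_LIMSEQ_iff)
    qed
    have f_lim: "birkhoff_avg U f w \<longlonglongrightarrow> lim (birkhoff_avg U f w)"
      using w(1) by (simp add: regular_set_def convergent_LIMSEQ_iff)
    obtain K where K: "\<And>z. \<bar>k z\<bar> \<le> K"
      using continuous_on_compact_UNIV_bounded[OF compact_Z k] by blast
    have le: "birkhoff_avg U (\<lambda>z. G (\<pi> z)) w n \<le> birkhoff_avg U f w n + 2 * K / real n" for n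
    proof -
      have "(\<Sum>j<n. G (\<pi> ((U ^^ j) w))) \<le> (\<Sum>j<n. f ((U ^^ j) w) + (k ((U ^^ Suc j) w) - k ((U ^^ j) w)))"
      proof (rule sum_mono)
        fix j
        show "G (\<pi> ((U ^^ j) w)) \<le> f ((U ^^ j) w) + (k ((U ^^ Suc j) w) - k ((U ^^ j) w))"
          using le_fiber_sup[OF h, of "(U ^^ j) w"] by (simp add: G_def h_def)
      qed
      \<comment> \<open>The coboundary telescopes to two boundary values, which the division by
        \<open>n\<close> removes in the limit.\<close>
      also have "\<dots> = (\<Sum>j<n. f ((U ^^ j) w)) + (k ((U ^^ n) w) - k w)"
        using sum_lessThan_telescope[of "\<lambda>j. k ((U ^^ j) w)" n] by (simp add: sum.distrib)
      also have "\<dots> \<le> (\<Sum>j<n. f ((U ^^ j) w)) + 2 * K"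
        using K[of "(U ^^ n) w"] K[of w] by linarith
      finally show ?thesis
        unfolding birkhoff_avg_def add_divide_distrib[symmetric] by (rule divide_right_mono) simp
    qed
    have "(\<lambda>n. birkhoff_avg U f w n + 2 * K / real n) \<longlonglongrightarrow> lim (birkhoff_avg U f w) + 0"
      using f_lim by (intro tendsto_add lim_const_over_n)
    then have "lim (birkhoff_avg U (\<lambda>z. G (\<pi> z)) z) \<le> lim (birkhoff_avg U f w) + 0"
      using le by (intro LIMSEQ_le[OF G_lim]) auto
    with c_lim show ?thesis by simp
  qed
  then show ?thesis using z(1) by (intro bexI[of _ "\<pi> z"]) auto
qed

text \<open>Boundedness of \<open>f\<close> bounds all limits, so the real infima and the supremum
  in \<open>beta\<close> compare as expected.\<close>

lemma le_beta:
  assumes f: "continuous_on UNIV f" and y: "y \<in> \<pi> ` regular_set U f"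
    and c: "\<And>z. z \<in> regular_set U f \<Longrightarrow> \<pi> z = y \<Longrightarrow> c \<le> lim (birkhoff_avg U f z)"
  shows "c \<le> beta U \<pi> f"
proof -
  obtain B where B: "\<And>z. \<bar>f z\<bar> \<le> B"
    using continuous_on_compact_UNIV_bounded[OF compact_Z f] by blast
  have lim_bounds: "- B \<le> lim (birkhoff_avg U f z)" "lim (birkhoff_avg U f z) \<le> B"
    if "z \<in> regular_set U f" for z
  proof -
    have "birkhoff_avg U f z \<longlonglongrightarrow> lim (birkhoff_avg U f z)"
      using that by (simp add: regular_set_def convergent_LIMSEQ_iff)
    moreover have "- B \<le> birkhoff_avg U f z n" "birkhoff_avg U f z n \<le> B" for n
      using birkhoff_avg_bound[of f B U z n, OF B] by linarith+
    ultimately show "- B \<le> lim (birkhoff_avg U f z)" "lim (birkhoff_avg U f z) \<le> B"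
      by (auto intro: LIMSEQ_le_const LIMSEQ_le_const2)
  qed
  let ?I = "\<lambda>y. INF z\<in>regular_set U f \<inter> \<pi> -` {y}. lim (birkhoff_avg U f z)"
  have "c \<le> ?I y"
    using y c by (intro cINF_greatest) auto
  also have "?I y \<le> beta U \<pi> f"
    unfolding beta_def
  proof (rule cSUP_upper[OF y], rule bdd_aboveI2)
    fix y' assume "y' \<in> \<pi> ` regular_set U f"
    then obtain z where z: "z \<in> regular_set U f" "\<pi> z = y'" by blast
    have "?I y' \<le> lim (birkhoff_avg U f z)"
      using z lim_bounds by (intro cINF_lower bdd_belowI2[where m = "- B"]) auto
    then show "?I y' \<le> B" using lim_bounds[OF z(1)] by simp
  qed
  finally show ?thesis .
qed

end

theorem theorem1p10:
  fixes U :: "'z::metric_space \<Rightarrow> 'z" and S :: "'y::metric_space \<Rightarrow> 'y"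
    and \<pi> :: "'z \<Rightarrow> 'y" and f :: "'z \<Rightarrow> real"
  assumes "tds U" and "tds S" and "factor_map U S \<pi>"
    and "\<forall>A. open A \<longrightarrow> open (\<pi> ` A)"
    and "continuous_on UNIV f"
  shows "alpha U S \<pi> f \<le> beta U \<pi> f"
proof -
  have cont: "continuous_on UNIV U" "continuous_on UNIV S"
    using assms(1,2) by (auto simp: tds_def homeomorphism_def)
  interpret open_factor U S \<pi>
    using assms cont by unfold_locales (auto simp: tds_def factor_map_def fun_eq_iff)
  have "compact (UNIV :: 'y set)" using assms(2) by (simp add: tds_def)
  then have nonempty: "inv_meas S \<noteq> {}" using cont(2) by (rule inv_meas_nonempty)
  have "psi U \<pi> f \<nu> \<le> beta U \<pi> f" if \<nu>: "\<nu> \<in> inv_meas S" for \<nu>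
  \<comment> \<open>The base point depends on \<open>c\<close>, so \<open>psi\<close> is approached
    strictly from below.\<close>
  proof (rule dense_le)
    fix c assume "c < psi U \<pi> f \<nu>"
    then obtain y where "y \<in> \<pi> ` regular_set U f"
      "\<forall>z\<in>regular_set U f \<inter> \<pi> -` {y}. c \<le> lim (birkhoff_avg U f z)"
      using fiber_point_bounded_below[OF \<nu> assms(5)] by blast
    then show "c \<le> beta U \<pi> f" by (intro le_beta[OF assms(5)]) auto
  qed
  then show ?thesis unfolding alpha_def using nonempty by (intro cSUP_least)
qed

end
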